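(* Let $G$ be a group with finite generating set $\mathcal G$. Then the following three problems for $(G,\mathcal G)$ are polynomial time and space reducible to each other: (Problem 3, geodesic problem) given a word $w$ in $\mathcal G^{\pm 1}$, find a geodesic representative for $w$; (Problem 4, geodesic length problem) given a word $w$ in $\mathcal G^{\pm 1}$, find the length of a geodesic representative for $w$; (Problem 5, bounded geodesic length problem) given a word $w$ in $\mathcal G^{\pm 1}$ and an integer $k$, decide whether a geodesic representative for $w$ has length $\leq k$.
   Context: The group $G$ and the finite generating set $\mathcal G$ are fixed. Words are elements of $(\mathcal G^{\pm 1})^*$, the finite words in the generators and their formal inverses. A geodesic representative of a word $w$ is a word in $(\mathcal G^{\pm 1})^*$ of minimal length among all words representing the same element of $G$ as $w$. Problem A is polynomial time and space reducible to Problem B if there is an algorithm that solves A, using calls to a solution of B as a subroutine, in such a way that if B is solvable in time and space polynomial in the size of its input, then A is solved in time and space polynomial in the size of its input (i.e. a polynomial Turing reduction). The size of the input is the length of its encoding. *)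

theory Defs
  imports "HOL-Algebra.Generated_Groups" "HOL-Computational_Algebra.Polynomial"
begin

section \<open>Deterministic multitape Turing machines with subroutine calls\<close>

text \<open>
  A tape is one-way infinite, with cells numbered from 0; \<open>None\<close> is the blank symbol.
  A machine is given by a number of tapes and a partial transition function with finite domain
  (so that the state set and the tape alphabet are finite, whatever the type \<open>'s\<close> of symbols).
  The start state is 0, and the machine halts when no transition is applicable.
  The finite map \<open>query\<close> assigns to each query state the state in which the machine resumes
  once the subroutine has returned; in a query state, \<open>trans\<close> is ignored.
\<close>

datatype move = Left | Right | Stay

record 's machine =
  tapes :: nat
  trans :: "nat \<times> 's option list \<rightharpoonup> nat \<times> ('s option \<times> move) list"
  query :: "nat \<rightharpoonup> nat"

text \<open>Tape 0 is the input and output tape, and tape 1 the query and answer tape.\<close>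

definition machine_wf :: "'s machine \<Rightarrow> bool" where
  "machine_wf M \<longleftrightarrow> 2 \<le> tapes M \<and> finite (dom (trans M)) \<and> finite (dom (query M)) \<and>
     (\<forall>k q as. trans M k = Some (q, as) \<longrightarrow> length as = tapes M)"

record 's config =
  state :: nat
  cells :: "nat \<Rightarrow> nat \<Rightarrow> 's option"
  head :: "nat \<Rightarrow> nat"

definition tape_of :: "'s list \<Rightarrow> nat \<Rightarrow> 's option" where
  "tape_of xs = (\<lambda>j. if j < length xs then Some (xs ! j) else None)"

text \<open>The string written on a tape from cell 0 up to the first blank.\<close>

definition tape_content :: "(nat \<Rightarrow> 's option) \<Rightarrow> 's list" where
  "tape_content t = map (\<lambda>j. the (t j)) [0..<(LEAST j. t j = None)]"

definition init :: "'s list \<Rightarrow> 's config" where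
  "init x = \<lparr>state = 0, cells = (\<lambda>i. if i = 0 then tape_of x else (\<lambda>_. None)), head = (\<lambda>_. 0)\<rparr>"

definition scanned :: "'s machine \<Rightarrow> 's config \<Rightarrow> 's option list" where
  "scanned M c = map (\<lambda>i. cells c i (head c i)) [0..<tapes M]"

text \<open>Moving left from cell 0 leaves the head at cell 0 (truncated subtraction).\<close>

fun move_head :: "move \<Rightarrow> nat \<Rightarrow> nat" where
  "move_head Left j = j - 1"
| "move_head Right j = j + 1"
| "move_head Stay j = j"

definition act :: "nat \<Rightarrow> ('s option \<times> move) list \<Rightarrow> 's config \<Rightarrow> 's config" where
  "act q as c =
     \<lparr>state = q,
      cells = (\<lambda>i. if i < length as then (cells c i)(head c i := fst (as ! i)) else cells c i),
      head = (\<lambda>i. if i < length as then move_head (snd (as ! i)) (head c i) else head c i)\<rparr>"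

text \<open>
  The subroutine is a function \<open>f\<close> on strings. A call replaces the whole of tape 1 by the
  answer and returns the head of that tape to cell 0. A halted configuration is left unchanged.
\<close>

definition step :: "'s machine \<Rightarrow> ('s list \<Rightarrow> 's list) \<Rightarrow> 's config \<Rightarrow> 's config" where
  "step M f c =
     (case query M (state c) of
        Some q \<Rightarrow> \<lparr>state = q,
                   cells = (cells c)(1 := tape_of (f (tape_content (cells c 1)))),
                   head = (head c)(1 := 0)\<rparr>
      | None \<Rightarrow>
          (case trans M (state c, scanned M c) of
             Some (q, as) \<Rightarrow> act q as c
           | None \<Rightarrow> c))"

definition halted :: "'s machine \<Rightarrow> 's config \<Rightarrow> bool" where
  "halted M c \<longleftrightarrow> query M (state c) = None \<and> trans M (state c, scanned M c) = None"

definition run :: "'s machine \<Rightarrow> ('s list \<Rightarrow> 's list) \<Rightarrow> 's list \<Rightarrow> nat \<Rightarrow> 's config" where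
  "run M f x n = (step M f ^^ n) (init x)"

definition result :: "'s config \<Rightarrow> 's list" where
  "result c = tape_content (cells c 0)"

section \<open>Time and space\<close>

text \<open>
  A call of the subroutine on a string \<open>y\<close> is charged \<open>q(|y|)\<close>, both in time and in space,
  where \<open>q\<close> is a polynomial bound on the resources of the subroutine. The time of a call is
  added to the number of steps. The space of the first \<open>n\<close> steps is the number of
  cells that are scanned or nonblank at some point, plus the largest amount charged for a
  single call (the working space of the subroutine is reused between calls).
\<close>

definition call_cost :: "nat poly \<Rightarrow> 's machine \<Rightarrow> 's config \<Rightarrow> nat" where
  "call_cost q M c =
     (if query M (state c) = None then 0 else poly q (length (tape_content (cells c 1))))"

definition run_time ::
    "nat poly \<Rightarrow> 's machine \<Rightarrow> ('s list \<Rightarrow> 's list) \<Rightarrow> 's list \<Rightarrow> nat \<Rightarrow> nat" where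
  "run_time q M f x n = (\<Sum>i<n. 1 + call_cost q M (run M f x i))"

definition used_cells :: "'s machine \<Rightarrow> 's config \<Rightarrow> (nat \<times> nat) set" where
  "used_cells M c = {(i, j). i < tapes M \<and> (cells c i j \<noteq> None \<or> head c i = j)}"

definition run_space ::
    "nat poly \<Rightarrow> 's machine \<Rightarrow> ('s list \<Rightarrow> 's list) \<Rightarrow> 's list \<Rightarrow> nat \<Rightarrow> nat" where
  "run_space q M f x n =
     card (\<Union>i\<le>n. used_cells M (run M f x i)) + Max ((\<lambda>i. call_cost q M (run M f x i)) ` {..n})"

section \<open>Problems and polynomial reducibility\<close>

text \<open>
  A problem relates each instance, encoded as a string, to its correct answers, also encoded as
  strings. The instances are the elements of the domain of the relation.
\<close>

type_synonym 's problem = "('s list \<times> 's list) set"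

definition solves :: "('s list \<Rightarrow> 's list) \<Rightarrow> 's problem \<Rightarrow> bool" where
  "solves f B \<longleftrightarrow> (\<forall>y\<in>Domain B. (y, f y) \<in> B)"

text \<open>
  One machine \<open>M\<close> has to work for every solution \<open>f\<close> of \<open>B\<close>; nothing is assumed about \<open>f\<close>
  outside the instances of \<open>B\<close>. First, \<open>M\<close> solves \<open>A\<close>, whatever the cost of \<open>f\<close>. Second,
  if \<open>f\<close> can be computed in time and space bounded by a polynomial \<open>q\<close> in the length of its
  argument (in particular its answers to instances of \<open>B\<close> obey this bound),
  then \<open>M\<close> runs in time and space bounded by a polynomial \<open>p\<close> in the length of its input.
\<close>

definition poly_reducible :: "'s problem \<Rightarrow> 's problem \<Rightarrow> bool" where
  "poly_reducible A B \<longleftrightarrow>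
     (\<exists>M. machine_wf M \<and>
       (\<forall>f. solves f B \<longrightarrow>
          (\<forall>x\<in>Domain A. \<exists>n. halted M (run M f x n) \<and> (x, result (run M f x n)) \<in> A)) \<and>
       (\<forall>q. \<exists>p. \<forall>f. solves f B \<and> (\<forall>y\<in>Domain B. length (f y) \<le> poly q (length y)) \<longrightarrow>
          (\<forall>x\<in>Domain A. \<exists>n. halted M (run M f x n) \<and>
             run_time q M f x n \<le> poly p (length x) \<and>
             run_space q M f x n \<le> poly p (length x))))"

section \<open>Words and geodesics\<close>

datatype 'a letter = Gen 'a | Inv 'a

definition group_words :: "'a set \<Rightarrow> 'a letter list set" where
  "group_words S = lists (Gen ` S \<union> Inv ` S)"

fun word_value :: "('a, 'b) monoid_scheme \<Rightarrow> 'a letter list \<Rightarrow> 'a" where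
  "word_value G [] = \<one>\<^bsub>G\<^esub>"
| "word_value G (Gen g # w) = g \<otimes>\<^bsub>G\<^esub> word_value G w"
| "word_value G (Inv g # w) = inv\<^bsub>G\<^esub> g \<otimes>\<^bsub>G\<^esub> word_value G w"

definition geodesic_rep ::
    "('a, 'b) monoid_scheme \<Rightarrow> 'a set \<Rightarrow> 'a letter list \<Rightarrow> 'a letter list \<Rightarrow> bool" where
  "geodesic_rep G S w u \<longleftrightarrow>
     is_arg_min length (\<lambda>v. v \<in> group_words S \<and> word_value G v = word_value G w) u"

section \<open>Encodings and the three problems\<close>

text \<open>
  Integers are written in binary, most significant digit first, without leading zeros,
  and with a minus sign if negative. Truth values are encoded by the digits one and zero.
\<close>

datatype 'a symbol = Letter "'a letter" | Zero | One | Minus | Comma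

definition encode_word :: "'a letter list \<Rightarrow> 'a symbol list" where
  "encode_word w = map Letter w"

definition encode_bool :: "bool \<Rightarrow> 'a symbol list" where
  "encode_bool b = [if b then One else Zero]"

fun encode_nat :: "nat \<Rightarrow> 'a symbol list" where
  "encode_nat n =
     (if n < 2 then encode_bool (n = 1) else encode_nat (n div 2) @ encode_bool (odd n))"

declare encode_nat.simps [simp del]

definition encode_int :: "int \<Rightarrow> 'a symbol list" where
  "encode_int k = (if k < 0 then Minus # encode_nat (nat (- k)) else encode_nat (nat k))"

definition geodesic_problem :: "('a, 'b) monoid_scheme \<Rightarrow> 'a set \<Rightarrow> 'a symbol problem" where
  "geodesic_problem G S =
     {(encode_word w, encode_word u) | w u. w \<in> group_words S \<and> geodesic_rep G S w u}"

definition geodesic_length_problem ::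
    "('a, 'b) monoid_scheme \<Rightarrow> 'a set \<Rightarrow> 'a symbol problem" where
  "geodesic_length_problem G S =
     {(encode_word w, encode_nat (length u)) | w u. w \<in> group_words S \<and> geodesic_rep G S w u}"

definition bounded_geodesic_length_problem ::
    "('a, 'b) monoid_scheme \<Rightarrow> 'a set \<Rightarrow> 'a symbol problem" where
  "bounded_geodesic_length_problem G S =
     {(encode_word w @ Comma # encode_int k, encode_bool (int (length u) \<le> k)) | w k u.
        w \<in> group_words S \<and> geodesic_rep G S w u}"

end

theory Submission
  imports Defs
begin

text \<open>
  Each of the three problems, used as a subroutine, answers the question whether the geodesic length
  of a word \<open>v\<close> is at most \<open>k\<close>, and each of them can be solved with polynomially many such questions.
  The length is the first \<open>k = 0, 1, \<dots>\<close> with a positive answer. A geodesic is found greedily: \<open>x\<close> is the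
  first letter of a geodesic for \<open>v\<close> iff \<open>x\<inverse>v\<close> has smaller geodesic length than \<open>v\<close>, so one searches for
  the least \<open>k\<close> such that some \<open>x\<inverse>v\<close> has length at most \<open>k\<close>, and continues with \<open>x\<inverse>v\<close>.
  The algorithms are programs of a small structured language whose commands act on tapes used as
  stacks; such programs compile to machines with the same number of steps.
\<close>

text \<open>Counting up by ones is affordable because a geodesic length never exceeds the length of
  the word. The bound \<open>k\<close> of the decision problem, in contrast, may be exponential in
  the length of its binary encoding; so it is never counted to, but only passed on in a question or
  compared digit by digit. A negative \<open>k\<close> is answered without any call. Since nothing
  is known about a solution \<open>f\<close> outside the instances of its problem, every executed
  call has to be shown to be made on an instance. Since one machine must serve all solutions, a
  program may depend on the letters and on the kind of subroutine, but not on \<open>f\<close>. In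
  the greedy construction the letter inverse to \<open>x\<close> is simply prepended to
  \<open>v\<close>, without cancellation. The word grows by one letter per round, but its geodesic
  length drops by exactly one, so the sum of the two stays constant and all questions keep a size
  linear in the input.\<close>

lemma poly_nat_mono:
  fixes p :: "nat poly"
  assumes "m \<le> n"
  shows "poly p m \<le> poly p n"
  using assms by (induction p) (auto intro!: add_mono mult_mono)

text \<open>A solution is constrained only on the instances \<open>D\<close>. Its answers can be
  bounded in length and in alphabet only as long as this condition holds at every step.\<close>

definition query_ok :: "'s machine \<Rightarrow> 's list set \<Rightarrow> 's config \<Rightarrow> bool" where
  "query_ok M D c \<longleftrightarrow> (query M (state c) \<noteq> None \<longrightarrow> tape_content (cells c 1) \<in> D)"

lemma length_tape_content_le:
  assumes "t k = None"
  shows "length (tape_content t) \<le> k"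
  using assms by (simp add: tape_content_def Least_le)

lemma run_Suc: "run M f x (Suc n) = step M f (run M f x n)"
  by (simp add: run_def)

text \<open>One bound for contents and head positions: it makes cell \<open>b\<close> blank on every
  tape, and that limits the length of the string on tape 1, hence the size and the cost of a
  question.\<close>

definition confined :: "nat \<Rightarrow> 's config \<Rightarrow> bool" where
  "confined b c \<longleftrightarrow> (\<forall>i j. cells c i j \<noteq> None \<longrightarrow> j < b) \<and> (\<forall>i. head c i < b)"

lemma confined_blank:
  assumes "confined b c"
  shows "cells c i b = None"
  using assms unfolding confined_def by (metis less_irrefl)

lemma move_head_le: "move_head m j \<le> Suc j"
  by (cases m) auto

text \<open>An ordinary step writes only under the heads and moves each of them by at most one cell.
  At a call, the question ends at the latest before the blank cell \<open>b\<close>, so the answer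
  fits into \<open>Suc b\<close> cells.\<close>

lemma confined_step:
  assumes c: "confined b c" and ok: "query_ok M D c"
    and len: "\<And>y. y \<in> D \<Longrightarrow> length (f y) \<le> Suc (length y)"
  shows "confined (Suc b) (step M f c)"
proof (cases "query M (state c)")
  case None
  show ?thesis
  proof (cases "trans M (state c, scanned M c)")
    case (Some r)
    obtain q as where r: "r = (q, as)" by (cases r)
    have "move_head m (head c i) < Suc b" for m i
      using c move_head_le[of m "head c i"] unfolding confined_def
      by (metis le_less_trans less_Suc_eq_le not_less_eq)
    then show ?thesis
      using c None Some r unfolding confined_def step_def act_def
      by (auto simp: less_Suc_eq)
  qed (use c None in \<open>auto simp: step_def confined_def less_Suc_eq\<close>)
next
  case (Some q)
  let ?y = "tape_content (cells c 1)"
  have "cells c 1 b = None" using c by (rule confined_blank)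
  then have "length ?y \<le> b" by (rule length_tape_content_le)
  moreover have "length (f ?y) \<le> Suc (length ?y)"
    using ok Some by (intro len) (simp add: query_ok_def)
  ultimately have "length (f ?y) \<le> Suc b" by simp
  then show ?thesis using c Some
    by (auto simp: step_def confined_def less_Suc_eq tape_of_def)
qed

lemma confined_run:
  assumes ok: "\<And>i. i < n \<Longrightarrow> query_ok M D (run M f x i)"
    and len: "\<And>y. y \<in> D \<Longrightarrow> length (f y) \<le> Suc (length y)"
    and "i \<le> n"
  shows "confined (Suc (length x + i)) (run M f x i)"
  using \<open>i \<le> n\<close>
proof (induction i)
  case 0
  show ?case by (auto simp: confined_def run_def init_def tape_of_def split: if_splits)
next
  case (Suc i)
  then show ?case using confined_step[OF _ ok len, of "Suc (length x + i)" i] by (simp add: run_Suc)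
qed

lemma call_cost_le:
  assumes "confined b c"
  shows "call_cost q M c \<le> poly q b"
proof -
  have "cells c 1 b = None" using assms by (rule confined_blank)
  then show ?thesis unfolding call_cost_def
    by (auto intro: poly_nat_mono length_tape_content_le)
qed

text \<open>
  If answers are at most one symbol longer than questions, then every step, including a call,
  enlarges the used part of the tapes by at most one cell. Therefore it suffices to bound the
  number of steps.
\<close>

lemma poly_reducibleI:
  assumes wf: "machine_wf M"
    and len: "\<And>y z. (y, z) \<in> B \<Longrightarrow> length z \<le> Suc (length y)"
    and run: "\<And>f x. solves f B \<Longrightarrow> x \<in> Domain A \<Longrightarrow>
      \<exists>n \<le> poly p0 (length x). halted M (run M f x n) \<and> (x, result (run M f x n)) \<in> A \<and>
        (\<forall>i<n. query_ok M (Domain B) (run M f x i))"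
  shows "poly_reducible A B"
  unfolding poly_reducible_def
proof (intro exI[of _ M] conjI allI impI ballI)
  show "machine_wf M" by (fact wf)
  show "\<exists>n. halted M (run M f x n) \<and> (x, result (run M f x n)) \<in> A"
    if "solves f B" "x \<in> Domain A" for f x
    using run[OF that] by blast
  fix q
  \<comment> \<open>\<open>b\<close> is one plus the input length plus the number of steps, the
    cells that can be reached on each tape. \<open>q'\<close> is the price of a question of that
    length. In \<open>p\<close>, the product pays for time, and the remaining sum for the cells of
    all tapes and the dearest call.\<close>
  define b where "b = [:1, 1:] + p0"
  define q' where "q' = pcompose q b"
  define p where "p = p0 * (1 + q') + (of_nat (tapes M) * b + q')"
  have poly_b: "poly b m = Suc (m + poly p0 m)" for m by (simp add: b_def)
  have poly_q': "poly q' m = poly q (poly b m)" for m by (simp add: q'_def poly_pcompose)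
  have poly_p: "poly p m = poly p0 m * (1 + poly q' m) + (tapes M * poly b m + poly q' m)" for m
    by (simp add: p_def)
  show "\<exists>p. \<forall>f. solves f B \<and> (\<forall>y\<in>Domain B. length (f y) \<le> poly q (length y)) \<longrightarrow>
          (\<forall>x\<in>Domain A. \<exists>n. halted M (run M f x n) \<and>
             run_time q M f x n \<le> poly p (length x) \<and> run_space q M f x n \<le> poly p (length x))"
  proof (intro exI[of _ p] allI impI ballI, elim conjE)
    fix f x assume f: "solves f B" and x: "x \<in> Domain A"
    obtain n where n: "n \<le> poly p0 (length x)" and h: "halted M (run M f x n)"
      and ok: "\<And>i. i < n \<Longrightarrow> query_ok M (Domain B) (run M f x i)"
      using run[OF f x] by blast
    have lenf: "length (f y) \<le> Suc (length y)" if "y \<in> Domain B" for y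
      using f that by (intro len) (simp add: solves_def)
    let ?b = "poly b (length x)"
    have w: "confined ?b (run M f x i)" if "i \<le> n" for i
    proof -
      have "Suc (length x + i) \<le> ?b" using that n by (simp add: poly_b)
      then show ?thesis using confined_run[of n M "Domain B" f x i, OF ok lenf that]
        unfolding confined_def by (meson less_le_trans)
    qed
    have cost: "call_cost q M (run M f x i) \<le> poly q' (length x)" if "i \<le> n" for i
      using call_cost_le[OF w[OF that]] by (simp add: poly_q')
    have "run_time q M f x n \<le> (\<Sum>i<n. 1 + poly q' (length x))"
      unfolding run_time_def by (intro sum_mono add_mono order.refl cost) auto
    also have "\<dots> = n * (1 + poly q' (length x))" by simp
    also have "\<dots> \<le> poly p0 (length x) * (1 + poly q' (length x))"
      using n by (intro mult_right_mono) auto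
    finally have time: "run_time q M f x n \<le> poly p (length x)" by (simp add: poly_p)
    have "(\<Union>i\<le>n. used_cells M (run M f x i)) \<subseteq> {..<tapes M} \<times> {..<?b}"
      using w by (fastforce simp: used_cells_def confined_def)
    then have "card (\<Union>i\<le>n. used_cells M (run M f x i)) \<le> card ({..<tapes M} \<times> {..<?b})"
      by (intro card_mono) auto
    then have "card (\<Union>i\<le>n. used_cells M (run M f x i)) \<le> tapes M * ?b" by simp
    moreover have "Max ((\<lambda>i. call_cost q M (run M f x i)) ` {..n}) \<le> poly q' (length x)"
      using cost by (subst Max_le_iff) auto
    ultimately have "run_space q M f x n \<le> poly p (length x)"
      unfolding run_space_def poly_p by linarith
    then show "\<exists>n. halted M (run M f x n) \<and>
        run_time q M f x n \<le> poly p (length x) \<and> run_space q M f x n \<le> poly p (length x)"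
      using time h by blast
  qed
qed

section \<open>Structured programs on ten tapes\<close>

text \<open>Two tapes for input, output and calls, and eight stacks: 2 for questions, answers and
  verdicts, 3 for the word, 4 for the bound, 5 for the geodesic under construction, 6 to 8 for
  scratch, and 9 for reading in an answer.\<close>

abbreviation num_tapes :: nat where "num_tapes \<equiv> 10"

type_synonym 's tapes = "(nat \<Rightarrow> nat \<Rightarrow> 's option) \<times> (nat \<Rightarrow> nat)"

type_synonym 's action = "(nat \<Rightarrow> 's option) \<Rightarrow> nat \<Rightarrow> 's option \<times> move"

datatype 's com =
    Act "'s action"
  | Query
  | Seq "'s com" "'s com" (infixr ";;" 60)
  | If "(nat \<Rightarrow> 's option) \<Rightarrow> bool" "'s com" "'s com"
  | While "(nat \<Rightarrow> 's option) \<Rightarrow> bool" "'s com"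

definition read_tapes :: "'s tapes \<Rightarrow> nat \<Rightarrow> 's option" where
  "read_tapes s i = (if i < num_tapes then fst s i (snd s i) else None)"

definition do_act :: "'s action \<Rightarrow> 's tapes \<Rightarrow> 's tapes" where
  "do_act g s =
     ((\<lambda>i. if i < num_tapes then (fst s i)(snd s i := fst (g (read_tapes s) i)) else fst s i),
      (\<lambda>i. if i < num_tapes then move_head (snd (g (read_tapes s) i)) (snd s i) else snd s i))"

definition do_query :: "('s list \<Rightarrow> 's list) \<Rightarrow> 's tapes \<Rightarrow> 's tapes" where
  "do_query f s = ((fst s)(1 := tape_of (f (tape_content (fst s 1)))), (snd s)(1 := 0))"

definition stay :: "'s action" where
  "stay r i = (r i, Stay)"

text \<open>The compiled transition table is finite and covers only symbols of
  \<open>\<Gamma>\<close>; on any other symbol the machine would halt in the middle of the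
  program.\<close>

definition tapes_in :: "'s set \<Rightarrow> 's tapes \<Rightarrow> bool" where
  "tapes_in \<Gamma> s \<longleftrightarrow> (\<forall>i j. fst s i j \<in> insert None (Some ` \<Gamma>))"

text \<open>The alphabet is \<open>\<Gamma>\<close>, and calls are only allowed on strings in \<open>D\<close>. The last argument counts steps.\<close>

inductive exec :: "'s set \<Rightarrow> ('s list \<Rightarrow> 's list) \<Rightarrow> 's list set \<Rightarrow> 's com \<Rightarrow> 's tapes \<Rightarrow> 's tapes \<Rightarrow> nat \<Rightarrow> bool"
  for \<Gamma> f D where
  exec_Act: "tapes_in \<Gamma> (do_act g s) \<Longrightarrow> exec \<Gamma> f D (Act g) s (do_act g s) 1"
| exec_Query: "tape_content (fst s 1) \<in> D \<Longrightarrow> tapes_in \<Gamma> (do_query f s) \<Longrightarrow>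
    exec \<Gamma> f D Query s (do_query f s) 1"
| exec_Seq: "exec \<Gamma> f D c s s' m \<Longrightarrow> exec \<Gamma> f D d s' s'' n \<Longrightarrow> exec \<Gamma> f D (c ;; d) s s'' (m + n)"
| exec_IfT: "P (read_tapes s) \<Longrightarrow> exec \<Gamma> f D c s s' n \<Longrightarrow> exec \<Gamma> f D (If P c d) s s' (1 + (n + 1))"
| exec_IfF: "\<not> P (read_tapes s) \<Longrightarrow> exec \<Gamma> f D d s s' n \<Longrightarrow> exec \<Gamma> f D (If P c d) s s' (1 + n)"
| exec_WhileT: "P (read_tapes s) \<Longrightarrow> exec \<Gamma> f D c s s' m \<Longrightarrow> exec \<Gamma> f D (While P c) s' s'' n \<Longrightarrow>
    exec \<Gamma> f D (While P c) s s'' (1 + (m + (1 + n)))"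
| exec_WhileF: "\<not> P (read_tapes s) \<Longrightarrow> exec \<Gamma> f D (While P c) s s 1"

subsection \<open>Compilation\<close>

datatype 's instr = Step "(nat \<Rightarrow> 's option) \<Rightarrow> nat \<times> (nat \<Rightarrow> 's option \<times> move)" | Invoke nat

definition jump :: "((nat \<Rightarrow> 's option) \<Rightarrow> nat) \<Rightarrow> 's instr" where
  "jump t = Step (\<lambda>r. (t r, stay r))"

fun size_com :: "'s com \<Rightarrow> nat" where
  "size_com (Act g) = 1"
| "size_com Query = 1"
| "size_com (c ;; d) = size_com c + size_com d"
| "size_com (If P c d) = 2 + size_com c + size_com d"
| "size_com (While P c) = 2 + size_com c"

text \<open>Addresses are absolute, and \<open>p\<close> is that of the first instruction. A
  conditional needs a test and a jump over the second branch, a loop a test and a jump back. Only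
  the first branch of a conditional executes its jump, hence the additional step charged in
  \<open>exec_IfT\<close>.\<close>

fun compile :: "'s com \<Rightarrow> nat \<Rightarrow> 's instr list" where
  "compile (Act g) p = [Step (\<lambda>r. (p + 1, g r))]"
| "compile Query p = [Invoke (p + 1)]"
| "compile (c ;; d) p = compile c p @ compile d (p + size_com c)"
| "compile (If P c d) p =
     jump (\<lambda>r. if P r then p + 1 else p + 2 + size_com c) #
     compile c (p + 1) @ jump (\<lambda>_. p + 2 + size_com c + size_com d) #
     compile d (p + 2 + size_com c)"
| "compile (While P c) p =
     jump (\<lambda>r. if P r then p + 1 else p + 2 + size_com c) # compile c (p + 1) @ [jump (\<lambda>_. p)]"

lemma length_compile [simp]: "length (compile c p) = size_com c"
  by (induction c arbitrary: p) auto

text \<open>Turns the scanned list back into the function that instructions expect. The default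
  \<open>None\<close> is the one in \<open>read_tapes\<close>, so that the two agree as functions on
  all indices.\<close>

definition nth_or_None :: "'s option list \<Rightarrow> nat \<Rightarrow> 's option" where
  "nth_or_None xs i = (if i < num_tapes then xs ! i else None)"

text \<open>Instructions are arbitrary functions; restricting the table to lists of the right length
  over \<open>\<Gamma>\<close> makes its domain finite. The address just after the program carries
  neither a transition nor a query, so running off the end means halting.\<close>

definition machine_of :: "'s set \<Rightarrow> 's instr list \<Rightarrow> 's machine" where
  "machine_of \<Gamma> is =
     \<lparr>tapes = num_tapes,
      trans = (\<lambda>(p, xs).
        if p < length is \<and> length xs = num_tapes \<and> set xs \<subseteq> insert None (Some ` \<Gamma>) then
          (case is ! p of
             Step h \<Rightarrow> Some (fst (h (nth_or_None xs)), map (snd (h (nth_or_None xs))) [0..<num_tapes])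
           | Invoke _ \<Rightarrow> None)
        else None),
      query = (\<lambda>p. if p < length is then (case is ! p of Step _ \<Rightarrow> None | Invoke q \<Rightarrow> Some q) else None)\<rparr>"

lemma tapes_machine_of [simp]: "tapes (machine_of \<Gamma> is) = num_tapes"
  by (simp add: machine_of_def)

lemma machine_wf_machine_of:
  assumes "finite \<Gamma>"
  shows "machine_wf (machine_of \<Gamma> is)"
proof -
  let ?M = "machine_of \<Gamma> is"
  let ?A = "insert None (Some ` \<Gamma>)"
  have "dom (trans ?M) \<subseteq> {..<length is} \<times> {xs. set xs \<subseteq> ?A \<and> length xs = num_tapes}"
    by (auto simp: machine_of_def split: if_splits)
  moreover have "finite ({..<length is} \<times> {xs. set xs \<subseteq> ?A \<and> length xs = num_tapes})"
    using assms by (intro finite_cartesian_product finite_lists_length_eq) auto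
  ultimately have "finite (dom (trans ?M))" by (rule finite_subset)
  moreover have "dom (query ?M) \<subseteq> {..<length is}"
    by (auto simp: machine_of_def split: if_splits)
  then have "finite (dom (query ?M))" by (rule finite_subset) simp
  moreover have "length as = num_tapes" if "trans ?M k = Some (q, as)" for k q as
    using that by (auto simp: machine_of_def split: if_splits prod.splits instr.splits)
  ultimately show ?thesis by (auto simp: machine_wf_def)
qed

definition config_of :: "nat \<Rightarrow> 's tapes \<Rightarrow> 's config" where
  "config_of p s = \<lparr>state = p, cells = fst s, head = snd s\<rparr>"

definition reaches ::
    "'s machine \<Rightarrow> ('s list \<Rightarrow> 's list) \<Rightarrow> 's list set \<Rightarrow> 's config \<Rightarrow> 's config \<Rightarrow> nat \<Rightarrow> bool" where
  "reaches M f D c c' n \<longleftrightarrow>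
     (step M f ^^ n) c = c' \<and> (\<forall>i<n. query_ok M D ((step M f ^^ i) c))"

lemma reaches_add:
  assumes "reaches M f D c c' m" and "reaches M f D c' c'' n"
  shows "reaches M f D c c'' (m + n)"
  unfolding reaches_def
proof (intro conjI allI impI)
  show "(step M f ^^ (m + n)) c = c''"
    using assms by (simp add: reaches_def funpow_add add.commute[of m])
  fix i assume i: "i < m + n"
  show "query_ok M D ((step M f ^^ i) c)"
  proof (cases "i < m")
    case False
    then have "(step M f ^^ i) c = (step M f ^^ (i - m)) c'"
      using assms(1) funpow_add[of "i - m" m "step M f"] by (simp add: reaches_def)
    then show ?thesis using assms(2) i False by (simp add: reaches_def)
  qed (use assms in \<open>auto simp: reaches_def\<close>)
qed

lemma nth_or_None_scanned:
  "nth_or_None (scanned (machine_of \<Gamma> is) (config_of p s)) = read_tapes s"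
  by (rule ext) (auto simp: nth_or_None_def scanned_def config_of_def read_tapes_def)

lemma reaches_Step:
  assumes "p < length is" and "is ! p = Step h" and "tapes_in \<Gamma> s"
  shows "reaches (machine_of \<Gamma> is) f D (config_of p s)
     (config_of (fst (h (read_tapes s))) (do_act (\<lambda>r. snd (h r)) s)) 1"
proof -
  let ?M = "machine_of \<Gamma> is" and ?r = "read_tapes s"
  let ?xs = "scanned ?M (config_of p s)"
  have "set ?xs \<subseteq> insert None (Some ` \<Gamma>)"
    using assms(3) by (auto simp: scanned_def config_of_def tapes_in_def)
  moreover have "length ?xs = num_tapes" by (simp add: scanned_def)
  ultimately have t: "trans ?M (p, ?xs) = Some (fst (h ?r), map (snd (h ?r)) [0..<num_tapes])"
    using assms by (simp add: machine_of_def nth_or_None_scanned[unfolded machine_of_def])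
  have q: "query ?M p = None" using assms by (simp add: machine_of_def)
  have "step ?M f (config_of p s) = act (fst (h ?r)) (map (snd (h ?r)) [0..<num_tapes]) (config_of p s)"
    using t q unfolding step_def by (simp add: config_of_def)
  also have "\<dots> = config_of (fst (h ?r)) (do_act (\<lambda>r. snd (h r)) s)"
    by (auto simp: act_def do_act_def config_of_def fun_eq_iff)
  finally show ?thesis using q
    by (simp add: reaches_def query_ok_def config_of_def)
qed

lemma do_act_stay [simp]: "do_act stay s = s"
  by (cases s) (auto simp: do_act_def stay_def read_tapes_def fun_eq_iff)

lemma reaches_jump:
  assumes "p < length is" and "is ! p = jump t" and "tapes_in \<Gamma> s"
  shows "reaches (machine_of \<Gamma> is) f D (config_of p s) (config_of (t (read_tapes s)) s) 1"
  using reaches_Step[OF assms(1) assms(2)[unfolded jump_def] assms(3), of f D] by simp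

text \<open>Arbitrary surrounding code \<open>pre\<close> and \<open>post\<close> is what makes the
  induction work: a subprogram is executed inside the code of the whole program, and its own code is
  generated for the address \<open>length pre\<close>. The alphabet condition is carried along
  because each later step presupposes it.\<close>

lemma compile_correct:
  assumes "exec \<Gamma> f D c s s' n" and "tapes_in \<Gamma> s"
  shows "tapes_in \<Gamma> s' \<and> (\<forall>pre post. reaches (machine_of \<Gamma> (pre @ compile c (length pre) @ post)) f D
     (config_of (length pre) s) (config_of (length pre + size_com c) s') n)"
  using assms
proof (induction rule: exec.induct)
  case (exec_Act g s)
  show ?case
  proof (intro conjI allI)
    fix pre post :: "'a instr list"
    show "reaches (machine_of \<Gamma> (pre @ compile (Act g) (length pre) @ post)) f D
        (config_of (length pre) s) (config_of (length pre + size_com (Act g)) (do_act g s)) 1"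
      using reaches_Step[of "length pre" "pre @ compile (Act g) (length pre) @ post"
          "\<lambda>r. (length pre + 1, g r)"] exec_Act.prems by simp
  qed (fact exec_Act.hyps)
next
  case (exec_Query s)
  show ?case
  proof (intro conjI allI)
    fix pre post :: "'a instr list"
    show "reaches (machine_of \<Gamma> (pre @ compile Query (length pre) @ post)) f D
        (config_of (length pre) s) (config_of (length pre + size_com Query) (do_query f s)) 1"
      using exec_Query.hyps
      by (simp add: reaches_def step_def query_ok_def machine_of_def config_of_def do_query_def)
  qed (fact exec_Query.hyps)
next
  case (exec_Seq c s s' m d s'' n)
  have ok: "tapes_in \<Gamma> s'" and ok': "tapes_in \<Gamma> s''" using exec_Seq by auto
  show ?case
  proof (intro conjI allI ok')
    fix pre post :: "'a instr list"
    let ?p = "length pre"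
    let ?M = "machine_of \<Gamma> (pre @ compile (c ;; d) ?p @ post)"
    have "reaches ?M f D (config_of ?p s) (config_of (?p + size_com c) s') m"
      using exec_Seq.IH(1)[OF exec_Seq.prems, THEN conjunct2, rule_format,
          of pre "compile d (?p + size_com c) @ post"] by simp
    moreover have "reaches ?M f D (config_of (?p + size_com c) s')
        (config_of (?p + size_com c + size_com d) s'') n"
      using exec_Seq.IH(2)[OF ok, THEN conjunct2, rule_format, of "pre @ compile c ?p" post] by simp
    ultimately show "reaches ?M f D (config_of ?p s) (config_of (?p + size_com (c ;; d)) s'') (m + n)"
      using reaches_add by (fastforce simp: add.assoc)
  qed
next
  case (exec_IfT P s c s' n d)
  show ?case
  proof (intro conjI allI)
    show ok': "tapes_in \<Gamma> s'" using exec_IfT by auto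
    fix pre post :: "'a instr list"
    let ?p = "length pre"
    let ?is = "pre @ compile (If P c d) ?p @ post"
    let ?M = "machine_of \<Gamma> ?is"
    let ?end = "?p + 2 + size_com c + size_com d"
    have 1: "reaches ?M f D (config_of ?p s) (config_of (?p + 1) s) 1"
      using reaches_jump[of ?p ?is "\<lambda>r. if P r then ?p + 1 else ?p + 2 + size_com c" \<Gamma> s f D] exec_IfT
      by simp
    have 2: "reaches ?M f D (config_of (?p + 1) s) (config_of (?p + 1 + size_com c) s') n"
      using exec_IfT.IH[OF exec_IfT.prems, THEN conjunct2, rule_format,
          of "pre @ [jump (\<lambda>r. if P r then ?p + 1 else ?p + 2 + size_com c)]"
          "jump (\<lambda>_. ?end) # compile d (?p + 2 + size_com c) @ post"] by simp
    have 3: "reaches ?M f D (config_of (?p + 1 + size_com c) s') (config_of ?end s') 1"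
      using reaches_jump[of "?p + 1 + size_com c" ?is "\<lambda>_. ?end" \<Gamma> s' f D] ok'
      by (simp add: nth_append)
    show "reaches ?M f D (config_of ?p s) (config_of (?p + size_com (If P c d)) s') (1 + (n + 1))"
      using reaches_add[OF 1 reaches_add[OF 2 3]] by (simp add: add.assoc)
  qed
next
  case (exec_IfF P s d s' n c)
  show ?case
  proof (intro conjI allI)
    show ok': "tapes_in \<Gamma> s'" using exec_IfF by auto
    fix pre post :: "'a instr list"
    let ?p = "length pre"
    let ?is = "pre @ compile (If P c d) ?p @ post"
    let ?M = "machine_of \<Gamma> ?is"
    let ?end = "?p + 2 + size_com c + size_com d"
    have 1: "reaches ?M f D (config_of ?p s) (config_of (?p + 2 + size_com c) s) 1"
      using reaches_jump[of ?p ?is "\<lambda>r. if P r then ?p + 1 else ?p + 2 + size_com c" \<Gamma> s f D] exec_IfF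
      by simp
    have 2: "reaches ?M f D (config_of (?p + 2 + size_com c) s) (config_of ?end s') n"
      using exec_IfF.IH[OF exec_IfF.prems, THEN conjunct2, rule_format,
          of "pre @ jump (\<lambda>r. if P r then ?p + 1 else ?p + 2 + size_com c) #
            compile c (?p + 1) @ [jump (\<lambda>_. ?end)]" post] by (simp add: add.assoc)
    show "reaches ?M f D (config_of ?p s) (config_of (?p + size_com (If P c d)) s') (1 + n)"
      using reaches_add[OF 1 2] by (simp add: add.assoc)
  qed
next
  case (exec_WhileT P s c s' m s'' n)
  have ok: "tapes_in \<Gamma> s'" and ok': "tapes_in \<Gamma> s''" using exec_WhileT by auto
  show ?case
  proof (intro conjI allI ok')
    fix pre post :: "'a instr list"
    let ?p = "length pre"
    let ?is = "pre @ compile (While P c) ?p @ post"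
    let ?M = "machine_of \<Gamma> ?is"
    have 1: "reaches ?M f D (config_of ?p s) (config_of (?p + 1) s) 1"
      using reaches_jump[of ?p ?is "\<lambda>r. if P r then ?p + 1 else ?p + 2 + size_com c" \<Gamma> s f D]
        exec_WhileT by simp
    have 2: "reaches ?M f D (config_of (?p + 1) s) (config_of (?p + 1 + size_com c) s') m"
      using exec_WhileT.IH(1)[OF exec_WhileT.prems, THEN conjunct2, rule_format,
          of "pre @ [jump (\<lambda>r. if P r then ?p + 1 else ?p + 2 + size_com c)]"
          "jump (\<lambda>_. ?p) # post"] by simp
    have 3: "reaches ?M f D (config_of (?p + 1 + size_com c) s') (config_of ?p s') 1"
      using reaches_jump[of "?p + 1 + size_com c" ?is "\<lambda>_. ?p" \<Gamma> s' f D] ok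
      by (simp add: nth_append)
    \<comment> \<open>After the jump back, the remaining iterations execute the same code at the
      same address, so \<open>pre\<close> and \<open>post\<close> are unchanged here.\<close>
    have 4: "reaches ?M f D (config_of ?p s') (config_of (?p + size_com (While P c)) s'') n"
      using exec_WhileT.IH(2)[OF ok, THEN conjunct2, rule_format, of pre post] by simp
    show "reaches ?M f D (config_of ?p s) (config_of (?p + size_com (While P c)) s'')
        (1 + (m + (1 + n)))"
      using reaches_add[OF 1 reaches_add[OF 2 reaches_add[OF 3 4]]] .
  qed
next
  case (exec_WhileF P s c)
  show ?case
  proof (intro conjI allI)
    fix pre post :: "'a instr list"
    let ?p = "length pre"
    let ?is = "pre @ compile (While P c) ?p @ post"
    show "reaches (machine_of \<Gamma> ?is) f D (config_of ?p s)
        (config_of (?p + size_com (While P c)) s) 1"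
      using reaches_jump[of ?p ?is "\<lambda>r. if P r then ?p + 1 else ?p + 2 + size_com c" \<Gamma> s f D]
        exec_WhileF by simp
  qed (fact exec_WhileF.prems)
qed

lemma exec_imp_run:
  assumes "exec \<Gamma> f D c (cells (init x), head (init x)) s n" and "set x \<subseteq> \<Gamma>"
  defines "M \<equiv> machine_of \<Gamma> (compile c 0)"
  shows "halted M (run M f x n) \<and> result (run M f x n) = tape_content (fst s 0) \<and>
    (\<forall>i<n. query_ok M D (run M f x i))"
proof -
  let ?s0 = "(cells (init x), head (init x))"
  have "tapes_in \<Gamma> ?s0"
    using assms(2) nth_mem by (fastforce simp: tapes_in_def init_def tape_of_def)
  then have "reaches M f D (config_of 0 ?s0) (config_of (size_com c) s) n"
    using compile_correct[OF assms(1)] unfolding M_def by (metis add_0 append.right_neutral append_Nil list.size(3))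
  moreover have "config_of 0 ?s0 = init x"
    by (simp add: config_of_def init_def)
  ultimately have r: "reaches M f D (init x) (config_of (size_com c) s) n" by simp
  have "halted M (config_of (size_com c) s)"
    by (simp add: M_def halted_def config_of_def machine_of_def)
  then show ?thesis using r
    by (simp add: reaches_def run_def result_def config_of_def)
qed

text \<open>The program \<open>c\<close> is fixed before \<open>f\<close> and \<open>x\<close>; only
  the run and the final tapes may depend on them. This is the uniformity demanded by
  \<open>poly_reducible\<close>.\<close>

theorem poly_reducible_program:
  assumes "finite \<Gamma>"
    and len: "\<And>y z. (y, z) \<in> B \<Longrightarrow> length z \<le> Suc (length y)"
    and inp: "\<And>x. x \<in> Domain A \<Longrightarrow> set x \<subseteq> \<Gamma>"
    and run: "\<And>f x. solves f B \<Longrightarrow> x \<in> Domain A \<Longrightarrow>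
      \<exists>s n. n \<le> poly p0 (length x) \<and> (x, tape_content (fst s 0)) \<in> A \<and>
        exec \<Gamma> f (Domain B) c (cells (init x), head (init x)) s n"
  shows "poly_reducible A B"
proof (rule poly_reducibleI[of "machine_of \<Gamma> (compile c 0)" B A p0])
  fix f x assume f: "solves f B" and x: "x \<in> Domain A"
  obtain s n where n: "n \<le> poly p0 (length x)" and "(x, tape_content (fst s 0)) \<in> A"
    and "exec \<Gamma> f (Domain B) c (cells (init x), head (init x)) s n"
    using run[OF f x] by blast
  then show "\<exists>n\<le>poly p0 (length x).
      halted (machine_of \<Gamma> (compile c 0)) (run (machine_of \<Gamma> (compile c 0)) f x n) \<and>
      (x, result (run (machine_of \<Gamma> (compile c 0)) f x n)) \<in> A \<and>
      (\<forall>i<n. query_ok (machine_of \<Gamma> (compile c 0)) (Domain B) (run (machine_of \<Gamma> (compile c 0)) f x i))"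
    using exec_imp_run[OF _ inp[OF x]] by metis
qed (use assms machine_wf_machine_of in auto)

section \<open>Tapes as stacks\<close>

text \<open>
  Tapes 2 to 9 hold stacks: cell 0 stays blank, so that the bottom can be recognised, and the head
  is on the topmost symbol. The head of a list is the top of the stack.
\<close>

fun stack_tape :: "'s list \<Rightarrow> nat \<Rightarrow> 's option" where
  "stack_tape [] = (\<lambda>_. None)"
| "stack_tape (x # xs) = (stack_tape xs)(Suc (length xs) := Some x)"

fun top_symbol :: "'s list \<Rightarrow> 's option" where
  "top_symbol [] = None"
| "top_symbol (x # xs) = Some x"

lemma top_symbol_eq_None [simp]: "top_symbol xs = None \<longleftrightarrow> xs = []"
  by (cases xs) auto

lemma stack_tape_length [simp]: "stack_tape xs (length xs) = top_symbol xs"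
  by (cases xs) auto

lemma stack_tape_beyond: "length xs < j \<Longrightarrow> stack_tape xs j = None"
  by (induction xs) auto

lemma stack_tape_tl: "stack_tape (tl xs) j = (if j = length xs then None else stack_tape xs j)"
  by (cases xs) (auto simp: stack_tape_beyond)

lemma stack_tape_in: "stack_tape xs j \<in> insert None (Some ` set xs)"
  by (induction xs) auto

type_synonym 's stacks = "nat \<Rightarrow> 's list"

type_synonym 's stconf = "'s stacks \<times> (nat \<Rightarrow> nat \<Rightarrow> 's option) \<times> (nat \<Rightarrow> nat)"

text \<open>The second and third components describe the contents and heads of tapes 0 and 1.\<close>

definition conf :: "'s stconf \<Rightarrow> 's tapes" where
  "conf = (\<lambda>(\<sigma>, C, H).
     ((\<lambda>i. if i < 2 then C i else if i < num_tapes then stack_tape (\<sigma> i) else (\<lambda>_. None)),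
      (\<lambda>i. if i < 2 then H i else if i < num_tapes then length (\<sigma> i) else 0)))"

lemma read_tapes_conf:
  "read_tapes (conf (\<sigma>, C, H)) i =
     (if i < 2 then C i (H i) else if i < num_tapes then top_symbol (\<sigma> i) else None)"
  by (simp add: read_tapes_def conf_def)

abbreviation stack_idx :: "nat set" where "stack_idx \<equiv> {2..<num_tapes}"

text \<open>A normal form for symbolic execution: updated actions and updated stacks both unfold
  into single-tape updates, which \<open>set_tape_comm\<close> sorts when the indices are known to
  be ordered. Effects of commands then become equations between such chains.\<close>

definition set_tape :: "nat \<Rightarrow> (nat \<Rightarrow> 's option) \<Rightarrow> nat \<Rightarrow> 's tapes \<Rightarrow> 's tapes" where
  "set_tape i t h s = ((fst s)(i := t), (snd s)(i := h))"

lemma set_tape_sel [simp]: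
  "fst (set_tape i t h s) j = (if j = i then t else fst s j)"
  "snd (set_tape i t h s) j = (if j = i then h else snd s j)"
  by (simp_all add: set_tape_def)

lemma set_tape_comm:
  "i < j \<Longrightarrow> set_tape j t h (set_tape i t' h' s) = set_tape i t' h' (set_tape j t h s)"
  by (auto simp: set_tape_def fun_upd_twist)

lemma do_act_upd:
  assumes "i < num_tapes"
  shows "do_act (\<lambda>r. (g r)(i := (w r, m))) s =
    set_tape i ((fst s i)(snd s i := w (read_tapes s))) (move_head m (snd s i)) (do_act g s)"
  using assms by (auto simp: do_act_def set_tape_def fun_eq_iff)

lemma conf_stack_upd:
  "i \<in> stack_idx \<Longrightarrow> conf (\<sigma>(i := xs), C, H) = set_tape i (stack_tape xs) (length xs) (conf (\<sigma>, C, H))"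
  by (auto simp: conf_def set_tape_def fun_eq_iff)

lemma conf_cells_upd:
  "t < 2 \<Longrightarrow> conf (\<sigma>, C(t := c), H) = set_tape t c (H t) (conf (\<sigma>, C, H))"
  by (auto simp: conf_def set_tape_def fun_eq_iff)

lemma conf_head_upd:
  "t < 2 \<Longrightarrow> conf (\<sigma>, C, H(t := h)) = set_tape t (C t) h (conf (\<sigma>, C, H))"
  by (auto simp: conf_def set_tape_def fun_eq_iff)

lemma conf_sel [simp]:
  "i \<in> stack_idx \<Longrightarrow> fst (conf (\<sigma>, C, H)) i = stack_tape (\<sigma> i)"
  "i \<in> stack_idx \<Longrightarrow> snd (conf (\<sigma>, C, H)) i = length (\<sigma> i)"
  "t < 2 \<Longrightarrow> fst (conf (\<sigma>, C, H)) t = C t"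
  "t < 2 \<Longrightarrow> snd (conf (\<sigma>, C, H)) t = H t"
  by (auto simp: conf_def)

lemma read_tapes_set_tape:
  "read_tapes (set_tape i t h s) j = (if j = i \<and> i < num_tapes then t h else read_tapes s j)"
  by (auto simp: read_tapes_def)

lemma tapes_in_do_act_move:
  assumes "tapes_in \<Gamma> s" and "\<And>r i. fst (g r i) = r i"
  shows "tapes_in \<Gamma> (do_act g s)"
  using assms by (auto simp: tapes_in_def do_act_def read_tapes_def)

text \<open>Two actions, since a machine step writes before it moves, whereas a push has to move to
  the free cell first. A pop erases and then moves, in one step.\<close>

definition push :: "nat \<Rightarrow> 's \<Rightarrow> 's com" where
  "push i a = Act (\<lambda>r. (stay r)(i := (r i, Right))) ;; Act (\<lambda>r. (stay r)(i := (Some a, Stay)))"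

definition pop :: "nat \<Rightarrow> 's com" where
  "pop i = Act (\<lambda>r. (stay r)(i := (None, Left)))"

definition while_nonempty :: "nat \<Rightarrow> 's com \<Rightarrow> 's com" where
  "while_nonempty i = While (\<lambda>r. r i \<noteq> None)"

definition while_top :: "nat \<Rightarrow> 's \<Rightarrow> 's com \<Rightarrow> 's com" where
  "while_top i a = While (\<lambda>r. r i = Some a)"

definition if_top :: "nat \<Rightarrow> 's \<Rightarrow> 's com \<Rightarrow> 's com \<Rightarrow> 's com" where
  "if_top i a = If (\<lambda>r. r i = Some a)"

definition clear :: "nat \<Rightarrow> 's com" where
  "clear i = while_nonempty i (pop i)"

text \<open>The targets \<open>j\<close> and \<open>k\<close> may coincide; then there is just one.\<close>

definition move_top :: "nat \<Rightarrow> nat \<Rightarrow> nat \<Rightarrow> 's com" where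
  "move_top i j k =
     Act (\<lambda>r. (stay r)(j := (r j, Right), k := (r k, Right))) ;;
     Act (\<lambda>r. (stay r)(j := (r i, Stay), k := (r i, Stay), i := (None, Left)))"

definition move_all :: "nat \<Rightarrow> nat \<Rightarrow> nat \<Rightarrow> 's com" where
  "move_all i j k = while_nonempty i (move_top i j k)"

definition read_cell :: "nat \<Rightarrow> nat \<Rightarrow> 's com" where
  "read_cell t a =
     Act (\<lambda>r. (stay r)(a := (r a, Right))) ;; Act (\<lambda>r. (stay r)(a := (r t, Stay), t := (r t, Right)))"

definition rewind_cell :: "nat \<Rightarrow> nat \<Rightarrow> nat \<Rightarrow> 's com" where
  "rewind_cell t a b =
     Act (\<lambda>r. (stay r)(b := (r b, Right))) ;;
     Act (\<lambda>r. (stay r)(b := (r a, Stay), a := (None, Left), t := (r t, Left)))"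

text \<open>Reading from left to right leaves the first symbol at the bottom of \<open>a\<close>;
  unloading \<open>a\<close> onto \<open>b\<close> puts it on top. The height of \<open>a\<close>
  equals the head position on tape \<open>t\<close>, so the unloading also brings that head back to
  cell 0.\<close>

definition read_from :: "nat \<Rightarrow> nat \<Rightarrow> nat \<Rightarrow> 's com" where
  "read_from t a b = while_nonempty t (read_cell t a) ;; while_nonempty a (rewind_cell t a b)"

definition write_cell :: "nat \<Rightarrow> nat \<Rightarrow> 's com" where
  "write_cell t a = Act (\<lambda>r. (stay r)(t := (r a, Right), a := (None, Left)))"

text \<open>The closing blank matters: the tape may still hold the input or an earlier, longer
  string, and \<open>tape_content\<close> stops at the first blank.\<close>

definition write_to :: "nat \<Rightarrow> nat \<Rightarrow> 's com" where
  "write_to t a = while_nonempty a (write_cell t a) ;; Act (\<lambda>r. (stay r)(t := (None, Stay)))"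

definition call :: "'s com" where
  "call = write_to 1 2 ;; Query ;; read_from 1 9 2"

lemma tape_content_prefix:
  assumes "\<And>i. i < length xs \<Longrightarrow> t i = Some (xs ! i)" and "t (length xs) = None"
  shows "tape_content t = xs"
proof -
  have "(LEAST j. t j = None) = length xs"
  proof (rule Least_equality)
    fix j assume "t j = None"
    then show "length xs \<le> j" using assms(1)[of j] by (cases "j < length xs") auto
  qed (fact assms(2))
  then show ?thesis using assms(1) by (auto simp: tape_content_def intro: nth_equalityI)
qed

section \<open>Execution rules for stack programs with a subroutine\<close>

locale subroutine =
  fixes \<Gamma> :: "'s set" and f :: "'s list \<Rightarrow> 's list" and D :: "'s list set"
  assumes answer_in: "y \<in> D \<Longrightarrow> set (f y) \<subseteq> \<Gamma>"
begin

definition conf_ok :: "'s stconf \<Rightarrow> bool" where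
  "conf_ok = (\<lambda>(\<sigma>, C, H). (\<forall>i\<in>stack_idx. set (\<sigma> i) \<subseteq> \<Gamma>) \<and>
     (\<forall>i j. C i j \<in> insert None (Some ` \<Gamma>)))"

lemma tapes_in_conf: "conf_ok S \<Longrightarrow> tapes_in \<Gamma> (conf S)"
  using stack_tape_in by (fastforce simp: conf_ok_def tapes_in_def conf_def split: prod.splits)

text \<open>The number of steps is only bounded from above, so that rough estimates can replace
  exact counts at any point. \<open>conf_ok\<close> is both assumed and reestablished, and hence
  passes silently through compositions.\<close>

definition goes :: "'s com \<Rightarrow> 's stconf \<Rightarrow> 's stconf \<Rightarrow> nat \<Rightarrow> bool" where
  "goes c S S' n \<longleftrightarrow> (conf_ok S \<longrightarrow> conf_ok S' \<and> (\<exists>m\<le>n. exec \<Gamma> f D c (conf S) (conf S') m))"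

lemma goesI:
  assumes "conf_ok S \<Longrightarrow> conf_ok S'" and "m \<le> n"
    and "conf_ok S \<Longrightarrow> conf_ok S' \<Longrightarrow> exec \<Gamma> f D c (conf S) (conf S') m"
  shows "goes c S S' n"
  using assms by (auto simp: goes_def)

lemma goesE:
  assumes "goes c S S' n" and "conf_ok S"
  obtains m where "conf_ok S'" "m \<le> n" "exec \<Gamma> f D c (conf S) (conf S') m"
  using assms by (auto simp: goes_def)

lemma goes_mono: "goes c S S' m \<Longrightarrow> m \<le> n \<Longrightarrow> goes c S S' n"
  by (auto simp: goes_def intro: le_trans)

lemma goes_eq: "goes c S S'' m \<Longrightarrow> S'' = S' \<Longrightarrow> m \<le> n \<Longrightarrow> goes c S S' n"
  by (auto intro: goes_mono)

lemma goes_Act: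
  assumes "do_act g (conf S) = conf S'" and "conf_ok S \<Longrightarrow> conf_ok S'"
  shows "goes (Act g) S S' 1"
proof (rule goesI[OF assms(2)])
  assume "conf_ok S'"
  then show "exec \<Gamma> f D (Act g) (conf S) (conf S') 1"
    using exec_Act[of \<Gamma> g "conf S" f D] assms(1) tapes_in_conf by simp
qed auto

text \<open>Between the two actions a head may stand one cell above the top of its stack, so the
  intermediate state need not be of the form \<open>conf\<close>. Its symbols nevertheless stay in
  \<open>\<Gamma>\<close>, because the first action rewrites what it reads.\<close>

lemma goes_Act_Act:
  assumes "\<And>r i. fst (g r i) = r i"
    and "do_act h (do_act g (conf S)) = conf S'" and "conf_ok S \<Longrightarrow> conf_ok S'"
  shows "goes (Act g ;; Act h) S S' 2"
  unfolding goes_def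
proof (intro impI conjI)
  assume ok: "conf_ok S"
  then show "conf_ok S'" by (rule assms)
  then have "exec \<Gamma> f D (Act h) (do_act g (conf S)) (conf S') 1"
    using exec_Act[of \<Gamma> h "do_act g (conf S)" f D] assms(2) by (simp add: tapes_in_conf)
  moreover have "exec \<Gamma> f D (Act g) (conf S) (do_act g (conf S)) 1"
    using tapes_in_do_act_move[of \<Gamma> "conf S" g] tapes_in_conf[OF ok] assms(1) by (intro exec_Act) auto
  ultimately have "exec \<Gamma> f D (Act g ;; Act h) (conf S) (conf S') (1 + 1)"
    by (metis exec_Seq)
  then show "\<exists>m\<le>2. exec \<Gamma> f D (Act g ;; Act h) (conf S) (conf S') m"
    by (intro exI[of _ "1 + 1"]) auto
qed

lemma goes_Seq:
  assumes "goes c S S' m" and "goes d S' S'' n"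
  shows "goes (c ;; d) S S'' (m + n)"
  unfolding goes_def
proof
  assume "conf_ok S"
  then obtain i j where "i \<le> m" "j \<le> n" "conf_ok S''"
    "exec \<Gamma> f D c (conf S) (conf S') i" "exec \<Gamma> f D d (conf S') (conf S'') j"
    using assms by (elim goesE)
  then show "conf_ok S'' \<and> (\<exists>k\<le>m + n. exec \<Gamma> f D (c ;; d) (conf S) (conf S'') k)"
    by (intro conjI exI[of _ "i + j"] exec_Seq) auto
qed

lemma goes_IfT:
  assumes "P (read_tapes (conf S))" and "goes c S S' n"
  shows "goes (If P c d) S S' (n + 2)"
  unfolding goes_def
proof
  assume "conf_ok S"
  then obtain m where "conf_ok S'" "m \<le> n" "exec \<Gamma> f D c (conf S) (conf S') m"
    using assms by (elim goesE)
  then show "conf_ok S' \<and> (\<exists>k\<le>n + 2. exec \<Gamma> f D (If P c d) (conf S) (conf S') k)"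
    using assms(1) by (intro conjI exI[of _ "1 + (m + 1)"] exec_IfT) auto
qed

lemma goes_IfF:
  assumes "\<not> P (read_tapes (conf S))" and "goes d S S' n"
  shows "goes (If P c d) S S' (n + 2)"
  unfolding goes_def
proof
  assume "conf_ok S"
  then obtain m where "conf_ok S'" "m \<le> n" "exec \<Gamma> f D d (conf S) (conf S') m"
    using assms by (elim goesE)
  then show "conf_ok S' \<and> (\<exists>k\<le>n + 2. exec \<Gamma> f D (If P c d) (conf S) (conf S') k)"
    using assms(1) by (intro conjI exI[of _ "1 + m"] exec_IfF) auto
qed

lemma goes_WhileT:
  assumes "P (read_tapes (conf S))" and "goes c S S' m" and "goes (While P c) S' S'' n"
  shows "goes (While P c) S S'' (m + n + 2)"
  unfolding goes_def
proof
  assume "conf_ok S"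
  then obtain i j where "i \<le> m" "j \<le> n" "conf_ok S''"
    "exec \<Gamma> f D c (conf S) (conf S') i" "exec \<Gamma> f D (While P c) (conf S') (conf S'') j"
    using assms by (elim goesE)
  then show "conf_ok S'' \<and> (\<exists>k\<le>m + n + 2. exec \<Gamma> f D (While P c) (conf S) (conf S'') k)"
    using assms(1) by (intro conjI exI[of _ "1 + (i + (1 + j))"] exec_WhileT) auto
qed

lemma goes_WhileF:
  assumes "\<not> P (read_tapes (conf S))"
  shows "goes (While P c) S S 1"
  by (rule goesI[OF _ order.refl exec_WhileF]) (use assms in auto)

lemmas act_simps = do_act_upd conf_stack_upd conf_cells_upd conf_head_upd
  read_tapes_set_tape read_tapes_conf

lemma conf_ok_stack_upd:
  "conf_ok (\<sigma>, C, H) \<Longrightarrow> set xs \<subseteq> \<Gamma> \<Longrightarrow> conf_ok (\<sigma>(i := xs), C, H')"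
  by (auto simp: conf_ok_def)

lemma conf_ok_stack: "conf_ok (\<sigma>, C, H) \<Longrightarrow> i \<in> stack_idx \<Longrightarrow> set (\<sigma> i) \<subseteq> \<Gamma>"
  by (auto simp: conf_ok_def)

text \<open>Generalised to an arbitrary head position for the induction on the unread part. The
  factor 4 is the two actions of the body together with test and jump back; the final 1 is the
  failing test.\<close>

lemma goes_read_from_forward:
  assumes "t < 2" and "a \<in> stack_idx" and "C t = tape_of x" and "H t \<le> length x"
  shows "goes (while_nonempty t (read_cell t a))
     (\<sigma>, C, H) (\<sigma>(a := rev (drop (H t) x) @ \<sigma> a), C, H(t := length x)) (4 * (length x - H t) + 1)"
  using assms
proof (induction "length x - H t" arbitrary: H \<sigma>)
  case 0
  then have "H t = length x" by simp
  then show ?case using goes_WhileF[of "\<lambda>r. r t \<noteq> None" "(\<sigma>, C, H)" "read_cell t a"] 0(2-)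
    by (simp add: while_nonempty_def read_tapes_conf tape_of_def fun_upd_idem)
next
  case (Suc n)
  let ?\<sigma> = "\<sigma>(a := x ! H t # \<sigma> a)" and ?H = "H(t := Suc (H t))"
  have less: "H t < length x" using Suc(2) by simp
  have body: "goes (read_cell t a) (\<sigma>, C, H) (?\<sigma>, C, ?H) 2"
  unfolding read_cell_def
  proof (rule goes_Act_Act)
    show "do_act (\<lambda>r. (stay r)(a := (r t, Stay), t := (r t, Right)))
        (do_act (\<lambda>r. (stay r)(a := (r a, Right))) (conf (\<sigma>, C, H))) = conf (?\<sigma>, C, ?H)"
      using Suc.prems less by (simp add: act_simps set_tape_comm ; auto simp: set_tape_def fun_eq_iff stack_tape_beyond stack_tape_tl tape_of_def)
    assume "conf_ok (\<sigma>, C, H)"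
    moreover from this have "C t (H t) \<in> insert None (Some ` \<Gamma>)" by (auto simp: conf_ok_def)
    then have "x ! H t \<in> \<Gamma>" using Suc.prems less by (auto simp: tape_of_def)
    ultimately show "conf_ok (?\<sigma>, C, ?H)" by (auto simp: conf_ok_def)
  qed (auto simp: stay_def)
  have rest: "goes (while_nonempty t (read_cell t a)) (?\<sigma>, C, ?H)
      (?\<sigma>(a := rev (drop (?H t) x) @ ?\<sigma> a), C, ?H(t := length x)) (4 * (length x - ?H t) + 1)"
    using Suc.prems Suc.hyps(2) less by (intro Suc.hyps(1)) auto
  have "goes (while_nonempty t (read_cell t a)) (\<sigma>, C, H)
      (?\<sigma>(a := rev (drop (?H t) x) @ ?\<sigma> a), C, ?H(t := length x)) (2 + (4 * (length x - ?H t) + 1) + 2)"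
    unfolding while_nonempty_def
    by (rule goes_WhileT[OF _ body rest[unfolded while_nonempty_def]]) (use Suc.prems less in \<open>simp add: read_tapes_conf tape_of_def\<close>)
  moreover have "rev (drop (Suc (H t)) x) @ x ! H t # \<sigma> a = rev (drop (H t) x) @ \<sigma> a"
    using less by (simp flip: Cons_nth_drop_Suc)
  moreover have "2 + (4 * (length x - ?H t) + 1) + 2 = 4 * (length x - H t) + 1"
    using less by simp
  ultimately show ?case by simp
qed

lemma goes_read_from_back:
  assumes "t < 2" and "a \<in> stack_idx" and "b \<in> stack_idx" and "a \<noteq> b" and "H t = length (\<sigma> a)"
  shows "goes (while_nonempty a (rewind_cell t a b))
     (\<sigma>, C, H) (\<sigma>(a := [], b := rev (\<sigma> a) @ \<sigma> b), C, H(t := 0)) (4 * length (\<sigma> a) + 1)"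
  using assms
proof (induction "\<sigma> a" arbitrary: \<sigma> H)
  case Nil
  then have eqs: "\<sigma>(a := [], b := rev (\<sigma> a) @ \<sigma> b) = \<sigma>" "H(t := 0) = H"
    by (auto simp: fun_eq_iff)
  have "goes (while_nonempty a (rewind_cell t a b)) (\<sigma>, C, H) (\<sigma>, C, H) 1"
    unfolding while_nonempty_def
    by (rule goes_WhileF) (use Nil in \<open>simp add: read_tapes_conf flip: Nil(1)\<close>)
  then show ?case unfolding eqs by (simp flip: Nil(1))
next
  case (Cons x xs)
  let ?\<sigma> = "\<sigma>(a := xs, b := x # \<sigma> b)" and ?H = "H(t := length xs)"
  have \<sigma>a: "\<sigma> a = x # xs" using Cons by simp
  have body: "goes (rewind_cell t a b) (\<sigma>, C, H) (?\<sigma>, C, ?H) 2"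
  unfolding rewind_cell_def
  proof (rule goes_Act_Act)
    show "do_act (\<lambda>r. (stay r)(b := (r a, Stay), a := (None, Left), t := (r t, Left)))
        (do_act (\<lambda>r. (stay r)(b := (r b, Right))) (conf (\<sigma>, C, H))) = conf (?\<sigma>, C, ?H)"
      using Cons.prems \<sigma>a by (simp add: act_simps set_tape_comm ; auto simp: set_tape_def fun_eq_iff stack_tape_beyond stack_tape_tl tape_of_def)
    show "conf_ok (\<sigma>, C, H) \<Longrightarrow> conf_ok (?\<sigma>, C, ?H)"
      using \<sigma>a Cons.prems(2,3) conf_ok_stack[of \<sigma> C H a] conf_ok_stack[of \<sigma> C H b]
      by (intro conf_ok_stack_upd) auto
  qed (auto simp: stay_def)
  have rest: "goes (while_nonempty a (rewind_cell t a b)) (?\<sigma>, C, ?H)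
      (?\<sigma>(a := [], b := rev (?\<sigma> a) @ ?\<sigma> b), C, ?H(t := 0)) (4 * length (?\<sigma> a) + 1)"
    using Cons.prems by (intro Cons.hyps(1)) auto
  have "goes (while_nonempty a (rewind_cell t a b)) (\<sigma>, C, H)
      (?\<sigma>(a := [], b := rev (?\<sigma> a) @ ?\<sigma> b), C, ?H(t := 0)) (2 + (4 * length (?\<sigma> a) + 1) + 2)"
    unfolding while_nonempty_def
    by (rule goes_WhileT[OF _ body rest[unfolded while_nonempty_def]])
      (use Cons.prems \<sigma>a in \<open>simp add: read_tapes_conf\<close>)
  then show ?case
    by (rule goes_eq) (use \<sigma>a Cons.prems in \<open>auto simp: fun_eq_iff\<close>)
qed

lemma goes_read_from:
  assumes "t < 2" and "a \<in> stack_idx" and "b \<in> stack_idx" and "a \<noteq> b" and "\<sigma> a = []"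
    and "C t = tape_of x" and "H t = 0"
  shows "goes (read_from t a b) (\<sigma>, C, H) (\<sigma>(b := x @ \<sigma> b), C, H) (8 * length x + 2)"
proof -
  let ?\<sigma> = "\<sigma>(a := rev x)" and ?H = "H(t := length x)"
  have 1: "goes (while_nonempty t (read_cell t a))
     (\<sigma>, C, H) (?\<sigma>, C, ?H) (4 * length x + 1)"
    using goes_read_from_forward[of t a C x H \<sigma>] assms by simp
  have "?\<sigma>(a := [], b := rev (?\<sigma> a) @ ?\<sigma> b) = \<sigma>(b := x @ \<sigma> b)" "?H(t := 0) = H"
    using assms by (auto simp: fun_eq_iff)
  then have 2: "goes (while_nonempty a (rewind_cell t a b))
     (?\<sigma>, C, ?H) (\<sigma>(b := x @ \<sigma> b), C, H) (4 * length x + 1)"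
    using goes_read_from_back[of t a b ?H ?\<sigma> C] assms(1-4) by simp
  show ?thesis unfolding read_from_def
    by (rule goes_mono[OF goes_Seq[OF 1 2]]) simp
qed

text \<open>The cells right of the written string are left open, as older symbols may remain there.
  That cells left of the start are kept is needed in the induction: the symbol just written lies to
  the left of where the rest begins.\<close>

lemma goes_write_to_loop:
  assumes "t < 2" and "a \<in> stack_idx"
  shows "\<exists>C'. (\<forall>i < length (\<sigma> a). C' t (H t + i) = Some (\<sigma> a ! i)) \<and> (\<forall>j < H t. C' t j = C t j) \<and>
     goes (while_nonempty a (write_cell t a))
      (\<sigma>, C, H) (\<sigma>(a := []), C', H(t := H t + length (\<sigma> a))) (3 * length (\<sigma> a) + 1)"
  using assms
proof (induction "\<sigma> a" arbitrary: \<sigma> C H)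
  case Nil
  then have "\<sigma>(a := []) = \<sigma>" "H(t := H t + length (\<sigma> a)) = H" by (auto simp: fun_eq_iff)
  moreover have "\<not> read_tapes (conf (\<sigma>, C, H)) a \<noteq> None" using Nil by (simp add: read_tapes_conf)
  ultimately show ?case
    using goes_WhileF[of "\<lambda>r. r a \<noteq> None" "(\<sigma>, C, H)"] Nil(1)[symmetric]
    by (intro exI[of _ C]) (simp add: while_nonempty_def)
next
  case (Cons x xs)
  let ?\<sigma> = "\<sigma>(a := xs)" and ?C = "C(t := (C t)(H t := Some x))" and ?H = "H(t := Suc (H t))"
  have \<sigma>a: "\<sigma> a = x # xs" using Cons by simp
  have body: "goes (write_cell t a) (\<sigma>, C, H) (?\<sigma>, ?C, ?H) 1"
    unfolding write_cell_def
  proof (rule goes_Act)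
    show "do_act (\<lambda>r. (stay r)(t := (r a, Right), a := (None, Left))) (conf (\<sigma>, C, H)) = conf (?\<sigma>, ?C, ?H)"
      using Cons.prems \<sigma>a by (simp add: act_simps set_tape_comm ; auto simp: set_tape_def fun_eq_iff stack_tape_beyond stack_tape_tl tape_of_def)
    show "conf_ok (\<sigma>, C, H) \<Longrightarrow> conf_ok (?\<sigma>, ?C, ?H)"
      using \<sigma>a Cons.prems(2) by (force simp: conf_ok_def)
  qed
  obtain C' where C': "\<forall>i < length xs. C' t (Suc (H t) + i) = Some (xs ! i)"
      "\<forall>j < Suc (H t). C' t j = ?C t j"
    and rest: "goes (while_nonempty a (write_cell t a)) (?\<sigma>, ?C, ?H)
      (?\<sigma>(a := []), C', ?H(t := Suc (H t) + length xs)) (3 * length xs + 1)"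
    using Cons.hyps(1)[of ?\<sigma> ?H ?C] Cons.prems by auto
  have "goes (while_nonempty a (write_cell t a)) (\<sigma>, C, H)
      (?\<sigma>(a := []), C', ?H(t := Suc (H t) + length xs)) (1 + (3 * length xs + 1) + 2)"
    unfolding while_nonempty_def
    by (rule goes_WhileT[OF _ body rest[unfolded while_nonempty_def]])
      (use Cons.prems \<sigma>a in \<open>simp add: read_tapes_conf\<close>)
  then have "goes (while_nonempty a (write_cell t a)) (\<sigma>, C, H) (\<sigma>(a := []), C', H(t := H t + length (\<sigma> a)))
      (3 * length (\<sigma> a) + 1)"
    by (rule goes_eq) (simp_all add: \<sigma>a)
  moreover have "C' t (H t + i) = Some (\<sigma> a ! i)" if "i < length (\<sigma> a)" for i
    using C' that \<sigma>a by (cases i) auto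
  moreover have "C' t j = C t j" if "j < H t" for j
    using C'(2) that by auto
  ultimately show ?case by blast
qed

lemma goes_write_to:
  assumes "t < 2" and "a \<in> stack_idx" and "H t = 0"
  shows "\<exists>C'. tape_content (C' t) = \<sigma> a \<and>
     goes (write_to t a) (\<sigma>, C, H) (\<sigma>(a := []), C', H(t := length (\<sigma> a))) (3 * length (\<sigma> a) + 2)"
proof -
  let ?H = "H(t := length (\<sigma> a))"
  obtain C' where C': "\<forall>i < length (\<sigma> a). C' t i = Some (\<sigma> a ! i)"
    and 1: "goes (while_nonempty a (write_cell t a))
      (\<sigma>, C, H) (\<sigma>(a := []), C', ?H) (3 * length (\<sigma> a) + 1)"
    using goes_write_to_loop[OF assms(1,2), of \<sigma> H C] assms(3) by auto
  let ?C = "C'(t := (C' t)(length (\<sigma> a) := None))"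
  have 2: "goes (Act (\<lambda>r. (stay r)(t := (None, Stay)))) (\<sigma>(a := []), C', ?H) (\<sigma>(a := []), ?C, ?H) 1"
  proof (rule goes_Act)
    show "do_act (\<lambda>r. (stay r)(t := (None, Stay))) (conf (\<sigma>(a := []), C', ?H)) = conf (\<sigma>(a := []), ?C, ?H)"
      using assms by (simp add: act_simps set_tape_comm ; auto simp: set_tape_def fun_eq_iff stack_tape_beyond stack_tape_tl tape_of_def)
    show "conf_ok (\<sigma>(a := []), C', ?H) \<Longrightarrow> conf_ok (\<sigma>(a := []), ?C, ?H)"
      by (auto simp: conf_ok_def)
  qed
  have "goes (write_to t a) (\<sigma>, C, H) (\<sigma>(a := []), ?C, ?H) (3 * length (\<sigma> a) + 2)"
    unfolding write_to_def by (rule goes_mono[OF goes_Seq[OF 1 2]]) simp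
  moreover have "tape_content (?C t) = \<sigma> a"
    using C' by (intro tape_content_prefix) auto
  ultimately show ?thesis by blast
qed

text \<open>Between calls the contents of tapes 0 and 1 do not matter as long as their heads are at
  cell 0; they are arbitrary before and existential after. What remains is a relation between stacks
  alone.\<close>

definition runs :: "'s com \<Rightarrow> 's stacks \<Rightarrow> 's stacks \<Rightarrow> nat \<Rightarrow> bool" where
  "runs c \<sigma> \<sigma>' n \<longleftrightarrow> (\<forall>C. \<exists>C'. goes c (\<sigma>, C, \<lambda>_. 0) (\<sigma>', C', \<lambda>_. 0) n)"

text \<open>Because \<open>runs\<close> hides tapes 0 and 1, the outcome of a test has to follow
  from the stack tops only.\<close>

definition stacks_top :: "'s stacks \<Rightarrow> (nat \<Rightarrow> 's option) \<Rightarrow> bool" where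
  "stacks_top \<sigma> r \<longleftrightarrow> (\<forall>i\<in>stack_idx. r i = top_symbol (\<sigma> i))"

lemma stacks_top_conf: "stacks_top \<sigma> (read_tapes (conf (\<sigma>, C, H)))"
  by (simp add: stacks_top_def read_tapes_conf)

lemma runs_mono: "runs c \<sigma> \<sigma>' m \<Longrightarrow> m \<le> n \<Longrightarrow> runs c \<sigma> \<sigma>' n"
  unfolding runs_def using goes_mono by blast

lemma runs_eq: "runs c \<sigma> \<sigma>'' m \<Longrightarrow> \<sigma>'' = \<sigma>' \<Longrightarrow> m \<le> n \<Longrightarrow> runs c \<sigma> \<sigma>' n"
  by (auto intro: runs_mono)

lemma runs_Seq: "runs c \<sigma> \<sigma>' m \<Longrightarrow> runs d \<sigma>' \<sigma>'' n \<Longrightarrow> runs (c ;; d) \<sigma> \<sigma>'' (m + n)"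
  unfolding runs_def using goes_Seq by blast

text \<open>Composition nests to the right, but leading commands are often summarised by one fact
  about their effect as a block; this inserts such a block into the longer program.\<close>

lemma runs_Seq_assoc:
  assumes "runs ((c ;; d) ;; e) \<sigma> \<sigma>' n"
  shows "runs (c ;; d ;; e) \<sigma> \<sigma>' n"
proof -
  have "exec \<Gamma> f D (c ;; d ;; e) s s' m" if "exec \<Gamma> f D ((c ;; d) ;; e) s s' m" for s s' m
    using that
  proof cases
    case outer: (exec_Seq s1 m1 m2)
    from outer(2) show ?thesis
    proof cases
      case (exec_Seq s2 k1 k2)
      then show ?thesis
        using outer(1) exec.exec_Seq[OF exec_Seq(2) exec.exec_Seq[OF exec_Seq(3) outer(3)]]
        by (simp add: add.assoc)
    qed
  qed
  then show ?thesis using assms unfolding runs_def goes_def by blast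
qed

lemma runs_IfT: "(\<And>r. stacks_top \<sigma> r \<Longrightarrow> P r) \<Longrightarrow> runs c \<sigma> \<sigma>' n \<Longrightarrow> runs (If P c d) \<sigma> \<sigma>' (n + 2)"
  unfolding runs_def by (meson goes_IfT stacks_top_conf)

lemma runs_IfF: "(\<And>r. stacks_top \<sigma> r \<Longrightarrow> \<not> P r) \<Longrightarrow> runs d \<sigma> \<sigma>' n \<Longrightarrow> runs (If P c d) \<sigma> \<sigma>' (n + 2)"
  unfolding runs_def by (meson goes_IfF stacks_top_conf)

lemma runs_WhileT:
  "(\<And>r. stacks_top \<sigma> r \<Longrightarrow> P r) \<Longrightarrow> runs c \<sigma> \<sigma>' m \<Longrightarrow> runs (While P c) \<sigma>' \<sigma>'' n \<Longrightarrow>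
     runs (While P c) \<sigma> \<sigma>'' (m + n + 2)"
  unfolding runs_def by (meson goes_WhileT stacks_top_conf)

lemma runs_WhileF: "(\<And>r. stacks_top \<sigma> r \<Longrightarrow> \<not> P r) \<Longrightarrow> runs (While P c) \<sigma> \<sigma> 1"
  unfolding runs_def by (meson goes_WhileF stacks_top_conf)

lemma runs_Act:
  assumes "\<And>C. do_act g (conf (\<sigma>, C, \<lambda>_. 0)) = conf (\<sigma>', C, \<lambda>_. 0)"
    and "\<And>C. conf_ok (\<sigma>, C, \<lambda>_. 0) \<Longrightarrow> conf_ok (\<sigma>', C, \<lambda>_. 0)"
  shows "runs (Act g) \<sigma> \<sigma>' 1"
  unfolding runs_def using goes_Act assms by blast

lemma runs_Act_Act:
  assumes "\<And>r i. fst (g r i) = r i"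
    and "\<And>C. do_act h (do_act g (conf (\<sigma>, C, \<lambda>_. 0))) = conf (\<sigma>', C, \<lambda>_. 0)"
    and "\<And>C. conf_ok (\<sigma>, C, \<lambda>_. 0) \<Longrightarrow> conf_ok (\<sigma>', C, \<lambda>_. 0)"
  shows "runs (Act g ;; Act h) \<sigma> \<sigma>' 2"
  unfolding runs_def using goes_Act_Act assms by blast

lemma runs_push:
  assumes "i \<in> stack_idx" and "a \<in> \<Gamma>"
  shows "runs (push i a) \<sigma> (\<sigma>(i := a # \<sigma> i)) 2"
  unfolding push_def
proof (rule runs_Act_Act)
  show "do_act (\<lambda>r. (stay r)(i := (Some a, Stay))) (do_act (\<lambda>r. (stay r)(i := (r i, Right)))
      (conf (\<sigma>, C, \<lambda>_. 0))) = conf (\<sigma>(i := a # \<sigma> i), C, \<lambda>_. 0)" for C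
    using assms by (simp add: act_simps set_tape_comm ; auto simp: set_tape_def fun_eq_iff stack_tape_beyond stack_tape_tl tape_of_def)
  show "conf_ok (\<sigma>, C, \<lambda>_. 0) \<Longrightarrow> conf_ok (\<sigma>(i := a # \<sigma> i), C, \<lambda>_. 0)" for C
    using assms conf_ok_stack[of \<sigma> C _ i] by (intro conf_ok_stack_upd) auto
qed (auto simp: stay_def)

lemma runs_pop:
  assumes "i \<in> stack_idx"
  shows "runs (pop i) \<sigma> (\<sigma>(i := tl (\<sigma> i))) 1"
  unfolding pop_def
proof (rule runs_Act)
  show "do_act (\<lambda>r. (stay r)(i := (None, Left))) (conf (\<sigma>, C, \<lambda>_. 0)) = conf (\<sigma>(i := tl (\<sigma> i)), C, \<lambda>_. 0)" for C
    using assms by (simp add: act_simps set_tape_comm ; auto simp: set_tape_def fun_eq_iff stack_tape_beyond stack_tape_tl tape_of_def)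
  show "conf_ok (\<sigma>, C, \<lambda>_. 0) \<Longrightarrow> conf_ok (\<sigma>(i := tl (\<sigma> i)), C, \<lambda>_. 0)" for C
    using assms conf_ok_stack[of \<sigma> C _ i] by (cases "\<sigma> i") (auto intro!: conf_ok_stack_upd)
qed

lemma runs_move_top:
  assumes "i \<in> stack_idx" "j \<in> stack_idx" "k \<in> stack_idx" "i \<noteq> j" "i \<noteq> k" and "\<sigma> i = x # xs"
  shows "runs (move_top i j k) \<sigma> (\<sigma>(i := xs, j := x # \<sigma> j, k := x # \<sigma> k)) 2"
  unfolding move_top_def
proof (rule runs_Act_Act)
  show "do_act (\<lambda>r. (stay r)(j := (r i, Stay), k := (r i, Stay), i := (None, Left)))
      (do_act (\<lambda>r. (stay r)(j := (r j, Right), k := (r k, Right))) (conf (\<sigma>, C, \<lambda>_. 0))) =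
    conf (\<sigma>(i := xs, j := x # \<sigma> j, k := x # \<sigma> k), C, \<lambda>_. 0)" for C
    using assms by (simp add: act_simps set_tape_comm ; auto simp: set_tape_def fun_eq_iff stack_tape_beyond stack_tape_tl tape_of_def)
  show "conf_ok (\<sigma>, C, \<lambda>_. 0) \<Longrightarrow> conf_ok (\<sigma>(i := xs, j := x # \<sigma> j, k := x # \<sigma> k), C, \<lambda>_. 0)" for C
    using assms conf_ok_stack[of \<sigma> C _ i] conf_ok_stack[of \<sigma> C _ j] conf_ok_stack[of \<sigma> C _ k]
    by (intro conf_ok_stack_upd) auto
qed (auto simp: stay_def)

lemma runs_while_nonemptyF: "i \<in> stack_idx \<Longrightarrow> \<sigma> i = [] \<Longrightarrow> runs (while_nonempty i c) \<sigma> \<sigma> 1"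
  unfolding while_nonempty_def by (rule runs_WhileF) (simp add: stacks_top_def)

lemma runs_while_nonemptyT:
  "i \<in> stack_idx \<Longrightarrow> \<sigma> i \<noteq> [] \<Longrightarrow> runs c \<sigma> \<sigma>' m \<Longrightarrow> runs (while_nonempty i c) \<sigma>' \<sigma>'' n \<Longrightarrow>
     runs (while_nonempty i c) \<sigma> \<sigma>'' (m + n + 2)"
  unfolding while_nonempty_def by (rule runs_WhileT) (auto simp: stacks_top_def)

lemma runs_while_topF: "i \<in> stack_idx \<Longrightarrow> top_symbol (\<sigma> i) \<noteq> Some a \<Longrightarrow> runs (while_top i a c) \<sigma> \<sigma> 1"
  unfolding while_top_def by (rule runs_WhileF) (simp add: stacks_top_def)

lemma runs_while_topT:
  "i \<in> stack_idx \<Longrightarrow> top_symbol (\<sigma> i) = Some a \<Longrightarrow> runs c \<sigma> \<sigma>' m \<Longrightarrow> runs (while_top i a c) \<sigma>' \<sigma>'' n \<Longrightarrow>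
     runs (while_top i a c) \<sigma> \<sigma>'' (m + n + 2)"
  unfolding while_top_def by (rule runs_WhileT) (auto simp: stacks_top_def)

lemma runs_if_topT:
  "i \<in> stack_idx \<Longrightarrow> top_symbol (\<sigma> i) = Some a \<Longrightarrow> runs c \<sigma> \<sigma>' n \<Longrightarrow> runs (if_top i a c d) \<sigma> \<sigma>' (n + 2)"
  unfolding if_top_def by (rule runs_IfT) (auto simp: stacks_top_def)

lemma runs_if_topF:
  "i \<in> stack_idx \<Longrightarrow> top_symbol (\<sigma> i) \<noteq> Some a \<Longrightarrow> runs d \<sigma> \<sigma>' n \<Longrightarrow> runs (if_top i a c d) \<sigma> \<sigma>' (n + 2)"
  unfolding if_top_def by (rule runs_IfF) (auto simp: stacks_top_def)

lemma runs_clear: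
  assumes "i \<in> stack_idx"
  shows "runs (clear i) \<sigma> (\<sigma>(i := [])) (3 * length (\<sigma> i) + 1)"
  using assms
proof (induction "\<sigma> i" arbitrary: \<sigma>)
  case Nil
  then have "\<sigma>(i := []) = \<sigma>" by (metis fun_upd_triv)
  then show ?case using Nil runs_while_nonemptyF[of i \<sigma>] unfolding clear_def
    by (metis add.commute add_0 list.size(3) mult_0_right)
next
  case (Cons x xs)
  have \<sigma>i: "\<sigma> i = x # xs" using Cons by simp
  let ?\<sigma> = "\<sigma>(i := tl (\<sigma> i))"
  have "runs (while_nonempty i (pop i)) ?\<sigma> (?\<sigma>(i := [])) (3 * length (?\<sigma> i) + 1)"
    using Cons.hyps(1)[of ?\<sigma>] Cons.prems \<sigma>i by (simp add: clear_def)
  from runs_while_nonemptyT[OF Cons.prems _ runs_pop[OF Cons.prems] this] show ?case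
    unfolding clear_def by (rule runs_eq) (simp_all add: \<sigma>i)
qed

lemma runs_move_all:
  assumes "i \<in> stack_idx" "j \<in> stack_idx" "k \<in> stack_idx" "i \<noteq> j" "i \<noteq> k"
  shows "runs (move_all i j k) \<sigma> (\<sigma>(i := [], j := rev (\<sigma> i) @ \<sigma> j, k := rev (\<sigma> i) @ \<sigma> k))
    (4 * length (\<sigma> i) + 1)"
  using assms
proof (induction "\<sigma> i" arbitrary: \<sigma>)
  case Nil
  then have "\<sigma>(i := [], j := rev (\<sigma> i) @ \<sigma> j, k := rev (\<sigma> i) @ \<sigma> k) = \<sigma>"
    by (auto simp: fun_eq_iff)
  then show ?case using Nil runs_while_nonemptyF[of i \<sigma>] unfolding move_all_def
    by (metis add.commute add_0 list.size(3) mult_0_right)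
next
  case (Cons x xs)
  let ?\<sigma> = "\<sigma>(i := xs, j := x # \<sigma> j, k := x # \<sigma> k)"
  have \<sigma>i: "\<sigma> i = x # xs" using Cons by simp
  have i: "?\<sigma> i = xs" using Cons.prems by simp
  have "runs (move_all i j k) ?\<sigma> (?\<sigma>(i := [], j := rev (?\<sigma> i) @ ?\<sigma> j, k := rev (?\<sigma> i) @ ?\<sigma> k))
      (4 * length (?\<sigma> i) + 1)"
    using Cons.prems i by (intro Cons.hyps(1)) auto
  from runs_while_nonemptyT[OF Cons.prems(1) _ runs_move_top[of i j k \<sigma>, OF Cons.prems \<sigma>i] this[unfolded move_all_def]]
  show ?case unfolding move_all_def
    by (rule runs_eq) (use \<sigma>i Cons.prems in \<open>auto simp: fun_eq_iff\<close>)
qed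

text \<open>Three steps per symbol for writing the question, eight for reading the answer twice
  over, and 5 for the two ends and the call itself. Stack 9 must be empty as it holds the answer in
  reverse in between.\<close>

lemma runs_call:
  assumes "\<sigma> 2 \<in> D" and "\<sigma> 9 = []"
  shows "runs call \<sigma> (\<sigma>(2 := f (\<sigma> 2))) (3 * length (\<sigma> 2) + 8 * length (f (\<sigma> 2)) + 5)"
  unfolding runs_def
proof
  fix C
  let ?y = "\<sigma> 2" and ?\<sigma> = "\<sigma>(2 := [])"
  obtain C' where C': "tape_content (C' 1) = ?y"
    and 1: "goes (write_to 1 2) (\<sigma>, C, \<lambda>_. 0) (?\<sigma>, C', (\<lambda>_. 0)(1 := length ?y)) (3 * length ?y + 2)"
    using goes_write_to[of 1 2 "\<lambda>_. 0" \<sigma> C] by auto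
  let ?C = "C'(1 := tape_of (f ?y))"
  let ?s = "conf (?\<sigma>, C', (\<lambda>_. 0)(1 := length ?y))"
  have q: "do_query f ?s = conf (?\<sigma>, ?C, \<lambda>_. 0)"
    using C' by (auto simp: do_query_def conf_def fun_eq_iff)
  have "set (f ?y) \<subseteq> \<Gamma>" using assms by (intro answer_in)
  then have ok: "conf_ok (?\<sigma>, ?C, \<lambda>_. 0)" if "conf_ok (?\<sigma>, C', (\<lambda>_. 0)(1 := length ?y))"
    using that nth_mem[of _ "f ?y"] by (fastforce simp: conf_ok_def tape_of_def)
  have "tape_content (fst ?s 1) \<in> D" using C' assms by (simp add: conf_def)
  then have 2: "goes Query (?\<sigma>, C', (\<lambda>_. 0)(1 := length ?y)) (?\<sigma>, ?C, \<lambda>_. 0) 1"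
    using ok exec_Query[of ?s D \<Gamma> f] q tapes_in_conf by (intro goesI[OF _ order.refl]) auto
  have 3: "goes (read_from 1 9 2) (?\<sigma>, ?C, \<lambda>_. 0) (?\<sigma>(2 := f ?y @ ?\<sigma> 2), ?C, \<lambda>_. 0) (8 * length (f ?y) + 2)"
    using assms by (intro goes_read_from) auto
  have "goes call (\<sigma>, C, \<lambda>_. 0) (\<sigma>(2 := f ?y), ?C, \<lambda>_. 0) (3 * length ?y + 8 * length (f ?y) + 5)"
    unfolding call_def using goes_mono[OF goes_Seq[OF 1 goes_Seq[OF 2 3]]] by simp
  then show "\<exists>C'. goes call (\<sigma>, C, \<lambda>_. 0) (\<sigma>(2 := f ?y), C', \<lambda>_. 0) (3 * length ?y + 8 * length (f ?y) + 5)"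
    by blast
qed

lemma exec_program:
  assumes "runs c ((\<lambda>_. [])(3 := x)) \<sigma> n" and "set x \<subseteq> \<Gamma>"
  shows "\<exists>s m. m \<le> n + 8 * length x + 3 * length (\<sigma> 2) + 4 \<and> tape_content (fst s 0) = \<sigma> 2 \<and>
    exec \<Gamma> f D (read_from 0 2 3 ;; c ;; write_to 0 2) (cells (init x), head (init x)) s m"
proof -
  let ?C = "(\<lambda>_ _. None)(0 := tape_of x)"
  \<comment> \<open>A blank tape with its head on cell 0 is an empty stack, so the initial
    configuration already has the required form.\<close>
  have init: "(cells (init x), head (init x)) = conf (\<lambda>_. [], ?C, \<lambda>_. 0)"
    by (auto simp: init_def conf_def fun_eq_iff)
  have 1: "goes (read_from 0 2 3) (\<lambda>_. [], ?C, \<lambda>_. 0) ((\<lambda>_. [])(3 := x @ []), ?C, \<lambda>_. 0) (8 * length x + 2)"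
    by (intro goes_read_from) auto
  obtain C' where 2: "goes c ((\<lambda>_. [])(3 := x), ?C, \<lambda>_. 0) (\<sigma>, C', \<lambda>_. 0) n"
    using assms(1) by (auto simp: runs_def)
  obtain C'' where C'': "tape_content (C'' 0) = \<sigma> 2"
    and 3: "goes (write_to 0 2) (\<sigma>, C', \<lambda>_. 0) (\<sigma>(2 := []), C'', (\<lambda>_. 0)(0 := length (\<sigma> 2))) (3 * length (\<sigma> 2) + 2)"
    using goes_write_to[of 0 2 "\<lambda>_. 0" \<sigma> C'] by auto
  have "conf_ok (\<lambda>_. [], ?C, \<lambda>_. 0)"
    using assms(2) nth_mem by (fastforce simp: conf_ok_def tape_of_def)
  then obtain m where "m \<le> (8 * length x + 2) + (n + (3 * length (\<sigma> 2) + 2))"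
    "exec \<Gamma> f D (read_from 0 2 3 ;; c ;; write_to 0 2) (conf (\<lambda>_. [], ?C, \<lambda>_. 0))
       (conf (\<sigma>(2 := []), C'', (\<lambda>_. 0)(0 := length (\<sigma> 2)))) m"
    using goes_Seq[OF 1[simplified] goes_Seq[OF 2 3]] unfolding goes_def by auto
  then show ?thesis unfolding init using C''
    by (intro exI[of _ "conf (\<sigma>(2 := []), C'', (\<lambda>_. 0)(0 := length (\<sigma> 2)))"] exI[of _ m])
      (auto simp: conf_def)
qed

end

section \<open>Binary numbers\<close>

text \<open>On the stacks, numbers are kept with the least significant digit on top.\<close>

definition digits :: "nat \<Rightarrow> 'a symbol list" where
  "digits n = rev (encode_nat n)"

text \<open>Defined on all lists, where every symbol other than \<open>One\<close>, and every
  missing digit, counts as zero. Numbers of different lengths can therefore be compared without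
  padding.\<close>

fun digits_value :: "'a symbol list \<Rightarrow> nat" where
  "digits_value [] = 0"
| "digits_value (a # xs) = of_bool (a = One) + 2 * digits_value xs"

fun inc_digits :: "'a symbol list \<Rightarrow> 'a symbol list" where
  "inc_digits [] = [One]"
| "inc_digits (a # xs) = (if a = One then Zero # inc_digits xs else One # xs)"

lemma digits_rec:
  "digits n = (if n < 2 then [if n = 1 then One else Zero]
     else (if odd n then One else Zero) # digits (n div 2))"
  by (subst digits_def, subst encode_nat.simps) (simp add: digits_def encode_bool_def)

lemma digits_0 [simp]: "digits 0 = [Zero]"
  by (simp add: digits_rec)

lemma digits_value_digits [simp]: "digits_value (digits n) = n"
proof (induction n rule: less_induct)
  case (less n)
  show ?case
  proof (cases "n < 2")
    case False
    then show ?thesis using less[of "n div 2"] by (subst digits_rec) (simp add: odd_two_times_div_two_succ)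
  next
    case True
    then show ?thesis by (subst digits_rec) (auto simp: less_2_cases_iff)
  qed
qed

text \<open>The carry either stops inside the number or appends a new leading \<open>One\<close>, so
  no leading zero arises and the result is again the canonical encoding. Counters can thus be used
  directly in questions and outputs.\<close>

lemma inc_digits_digits: "inc_digits (digits n) = (digits (Suc n) :: 'a symbol list)"
proof (induction n rule: less_induct)
  case (less n)
  show ?case
  proof (cases "n < 2")
    case True
    then consider "n = 0" | "n = 1" by linarith
    then show ?thesis by cases (simp_all add: digits_rec[of "Suc _"] digits_rec[of 1])
  next
    case False
    then have IH: "inc_digits (digits (n div 2)) = (digits (Suc (n div 2)) :: 'a symbol list)"
      by (intro less) simp
    show ?thesis
    proof (cases "odd n")
      case True
      then have "Suc n div 2 = Suc (n div 2)" by presburger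
      then show ?thesis using True False IH by (simp add: digits_rec[of n] digits_rec[of "Suc n"])
    next
      case 2: False
      then have "Suc n div 2 = n div 2" by presburger
      then show ?thesis using 2 False by (simp add: digits_rec[of n] digits_rec[of "Suc n"])
    qed
  qed
qed

lemma length_inc_digits: "length (inc_digits xs) \<le> Suc (length xs)"
  by (induction xs) auto

lemma length_digits_le: "length (digits n :: 'a symbol list) \<le> Suc n"
proof (induction n)
  case (Suc n)
  then show ?case using length_inc_digits[of "digits n :: 'a symbol list"] by (simp add: inc_digits_digits)
qed simp

lemma set_digits: "set (digits n) \<subseteq> {Zero, One}"
proof (induction n rule: less_induct)
  case (less n)
  then show ?case
    by (cases "n < 2") (auto simp: digits_rec[of n])
qed

lemma set_encode_nat: "set (encode_nat n) \<subseteq> {Zero, One}"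
  using set_digits[of n] by (simp add: digits_def)

lemma length_encode_nat_le: "length (encode_nat n) \<le> Suc n"
  using length_digits_le[of n] by (simp add: digits_def)

lemma encode_nat_inject: "encode_nat m = encode_nat n \<Longrightarrow> m = n"
  by (metis digits_def digits_value_digits)

lemma encode_int_inject:
  assumes "encode_int k = (encode_int l :: 'a symbol list)"
  shows "k = l"
proof -
  have neq: "encode_nat n \<noteq> Minus # xs" for n and xs :: "'a symbol list"
    using set_encode_nat[of n, where 'a = 'a] by auto
  show ?thesis
    using assms neq neq[symmetric] by (auto simp: encode_int_def split: if_splits dest!: encode_nat_inject)
qed

text \<open>The leading run of \<open>One\<close> is parked on \<open>j\<close> as zeros. The
  following pop removes a non-\<open>One\<close> digit, or does nothing at the bottom of the stack;
  either way a \<open>One\<close> takes its place and the zeros return.\<close>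

definition incr :: "nat \<Rightarrow> nat \<Rightarrow> 'a symbol com" where
  "incr i j = while_top i One (pop i ;; push j Zero) ;; pop i ;; push i One ;; move_all j i i"

text \<open>Digits arrive least significant first, so the last differing pair decides and the
  verdict on \<open>k\<close> is overwritten at every difference. An exhausted stack reads as blank,
  counts as zero, and survives further pops.\<close>

definition compare_digit :: "nat \<Rightarrow> nat \<Rightarrow> nat \<Rightarrow> 'a symbol com" where
  "compare_digit i j k =
     Act (\<lambda>r. (stay r)(
       k := (if r i = Some One \<and> r j \<noteq> Some One then Some Zero
             else if r i \<noteq> Some One \<and> r j = Some One then Some One else r k, Stay),
       i := (None, Left), j := (None, Left)))"

definition compare :: "nat \<Rightarrow> nat \<Rightarrow> nat \<Rightarrow> 'a symbol com" where
  "compare i j k = push k One ;; While (\<lambda>r. r i \<noteq> None \<or> r j \<noteq> None) (compare_digit i j k)"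

text \<open>Unloading a stack reverses it, so the two passes restore the order. In the first one
  both targets are the scratch stack, in the second they are the original and the copy.\<close>

definition copy :: "nat \<Rightarrow> nat \<Rightarrow> nat \<Rightarrow> 's com" where
  "copy i j k = move_all i k k ;; move_all k i j"

lemma (in subroutine) runs_copy:
  assumes "i \<in> stack_idx" "j \<in> stack_idx" "k \<in> stack_idx" "i \<noteq> j" "i \<noteq> k" "j \<noteq> k" and "\<sigma> k = []"
  shows "runs (copy i j k) \<sigma> (\<sigma>(j := \<sigma> i @ \<sigma> j)) (8 * length (\<sigma> i) + 2)"
proof -
  have "runs (move_all i k k) \<sigma> (\<sigma>(i := [], k := rev (\<sigma> i))) (4 * length (\<sigma> i) + 1)"
    by (rule runs_eq[OF runs_move_all]) (use assms in auto)
  moreover have "runs (move_all k i j) (\<sigma>(i := [], k := rev (\<sigma> i))) (\<sigma>(j := \<sigma> i @ \<sigma> j)) (4 * length (\<sigma> i) + 1)"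
    by (rule runs_eq[OF runs_move_all]) (use assms in \<open>auto simp: fun_eq_iff\<close>)
  ultimately show ?thesis unfolding copy_def by (rule runs_eq[OF runs_Seq]) auto
qed

definition bool_symbol :: "bool \<Rightarrow> 'a symbol" where
  "bool_symbol b = (if b then One else Zero)"

lemma encode_bool_eq: "encode_bool b = [bool_symbol b]"
  by (simp add: encode_bool_def bool_symbol_def)

lemma bool_symbol_simps [simp]: "bool_symbol True = One" "bool_symbol False = Zero" "bool_symbol b = One \<longleftrightarrow> b" "bool_symbol b = Zero \<longleftrightarrow> \<not> b"
  by (auto simp: bool_symbol_def)

lemma digits_value_unfold:
  "digits_value xs = of_bool (top_symbol xs = Some One) + 2 * digits_value (tl xs)"
  by (cases xs) auto

text \<open>The invariant of the comparison: the unread higher digits decide, and if they agree, the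
  verdict \<open>b\<close> on the lower digits already read does.\<close>

lemma digits_value_le_step:
  fixes xs ys :: "'a symbol list"
  defines "x \<equiv> top_symbol xs = Some One" and "y \<equiv> top_symbol ys = Some One"
  shows "digits_value (tl xs) < digits_value (tl ys) \<or>
      digits_value (tl xs) = digits_value (tl ys) \<and> (if x \<and> \<not> y then False else if \<not> x \<and> y then True else b) \<longleftrightarrow>
    digits_value xs < digits_value ys \<or> digits_value xs = digits_value ys \<and> b"
  unfolding digits_value_unfold[of xs] digits_value_unfold[of ys] x_def[symmetric] y_def[symmetric]
  by (cases x; cases y) (simp_all, arith+)

locale digit_routines = subroutine \<Gamma> f D
  for \<Gamma> :: "'a symbol set" and f :: "'a symbol list \<Rightarrow> 'a symbol list" and D :: "'a symbol list set" +
  assumes digits_in: "{Zero, One} \<subseteq> \<Gamma>"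
begin

lemma bool_symbol_in [simp]: "bool_symbol b \<in> \<Gamma>" "Zero \<in> \<Gamma>" "One \<in> \<Gamma>"
  using digits_in by (auto simp: bool_symbol_def)

lemma runs_incr_carry:
  assumes "i \<in> stack_idx" "j \<in> stack_idx" "i \<noteq> j"
  shows "runs (while_top i One (pop i ;; push j Zero)) \<sigma>
    (\<sigma>(i := dropWhile (\<lambda>a. a = One) (\<sigma> i),
       j := replicate (length (takeWhile (\<lambda>a. a = One) (\<sigma> i))) Zero @ \<sigma> j))
    (5 * length (\<sigma> i) + 1)"
  using assms
proof (induction "\<sigma> i" arbitrary: \<sigma>)
  case Nil
  have "runs (while_top i One (pop i ;; push j Zero)) \<sigma> \<sigma> 1"
    using Nil(1)[symmetric] Nil by (intro runs_while_topF) auto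
  then show ?case by (rule runs_eq) (auto simp: fun_eq_iff Nil(1)[symmetric])
next
  case (Cons a xs)
  have \<sigma>i: "\<sigma> i = a # xs" using Cons by simp
  show ?case
  proof (cases "a = One")
    case True
    let ?\<sigma> = "\<sigma>(i := xs, j := Zero # \<sigma> j)"
    have 1: "runs (pop i ;; push j Zero) \<sigma> ?\<sigma> 3"
      by (rule runs_eq[OF runs_Seq[OF runs_pop runs_push]]) (use Cons.prems \<sigma>i in \<open>auto simp: fun_eq_iff\<close>)
    have i: "?\<sigma> i = xs" using Cons.prems by simp
    have "runs (while_top i One (pop i ;; push j Zero)) \<sigma>
      (?\<sigma>(i := dropWhile (\<lambda>a. a = One) (?\<sigma> i),
         j := replicate (length (takeWhile (\<lambda>a. a = One) (?\<sigma> i))) Zero @ ?\<sigma> j))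
      (3 + (5 * length (?\<sigma> i) + 1) + 2)"
      by (rule runs_while_topT[OF Cons.prems(1) _ 1 Cons.hyps(1)]) (use Cons.prems \<sigma>i True i in auto)
    then show ?thesis
      by (rule runs_eq) (use Cons.prems \<sigma>i True in \<open>auto simp: fun_eq_iff replicate_app_Cons_same\<close>)
  next
    case False
    have "runs (while_top i One (pop i ;; push j Zero)) \<sigma> \<sigma> 1"
      using False \<sigma>i Cons.prems by (intro runs_while_topF) auto
    then show ?thesis by (rule runs_eq) (use False \<sigma>i in auto)
  qed
qed

lemma inc_digits_eq:
  "inc_digits xs = replicate (length (takeWhile (\<lambda>a. a = One) xs)) Zero @ One # tl (dropWhile (\<lambda>a. a = One) xs)"
  by (induction xs) auto

lemma runs_incr:
  assumes "i \<in> stack_idx" "j \<in> stack_idx" "i \<noteq> j" and "\<sigma> j = []"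
  shows "runs (incr i j) \<sigma> (\<sigma>(i := inc_digits (\<sigma> i))) (9 * length (\<sigma> i) + 5)"
  unfolding incr_def
  by (rule runs_eq[OF runs_Seq[OF runs_incr_carry runs_Seq[OF runs_pop runs_Seq[OF runs_push runs_move_all]]]])
    (use assms length_takeWhile_le[of "\<lambda>a. a = One" "\<sigma> i"] in \<open>auto simp: fun_eq_iff inc_digits_eq\<close>)

lemma runs_compare_digit:
  assumes "i \<in> stack_idx" "j \<in> stack_idx" "k \<in> stack_idx" "i \<noteq> j" "i \<noteq> k" "j \<noteq> k" and "\<sigma> k = bool_symbol b # zs"
  defines "x \<equiv> top_symbol (\<sigma> i) = Some One" and "y \<equiv> top_symbol (\<sigma> j) = Some One"
  shows "runs (compare_digit i j k) \<sigma>
    (\<sigma>(i := tl (\<sigma> i), j := tl (\<sigma> j),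
       k := bool_symbol (if x \<and> \<not> y then False else if \<not> x \<and> y then True else b) # zs)) 1"
  unfolding compare_digit_def
proof (rule runs_Act)
  let ?\<sigma> = "\<sigma>(i := tl (\<sigma> i), j := tl (\<sigma> j),
       k := bool_symbol (if x \<and> \<not> y then False else if \<not> x \<and> y then True else b) # zs)"
  show "do_act (\<lambda>r. (stay r)(
       k := (if r i = Some One \<and> r j \<noteq> Some One then Some Zero
             else if r i \<noteq> Some One \<and> r j = Some One then Some One else r k, Stay),
       i := (None, Left), j := (None, Left))) (conf (\<sigma>, C, \<lambda>_. 0)) = conf (?\<sigma>, C, \<lambda>_. 0)" for C
    using assms(1-7) unfolding x_def y_def
    by (simp add: act_simps ; auto simp: set_tape_def fun_eq_iff stack_tape_tl)
  have "set (tl xs) \<subseteq> \<Gamma>" if "set xs \<subseteq> \<Gamma>" for xs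
    using that by (cases xs) auto
  then show "conf_ok (\<sigma>, C, \<lambda>_. 0) \<Longrightarrow> conf_ok (?\<sigma>, C, \<lambda>_. 0)" for C
    using assms(1-7) conf_ok_stack[of \<sigma> C _ i] conf_ok_stack[of \<sigma> C _ j] conf_ok_stack[of \<sigma> C _ k]
    by (intro conf_ok_stack_upd) auto
qed

lemma runs_compare_loop:
  assumes "i \<in> stack_idx" "j \<in> stack_idx" "k \<in> stack_idx" "i \<noteq> j" "i \<noteq> k" "j \<noteq> k" and "\<sigma> k = bool_symbol b # zs"
  shows "runs (While (\<lambda>r. r i \<noteq> None \<or> r j \<noteq> None) (compare_digit i j k)) \<sigma>
    (\<sigma>(i := [], j := [],
       k := bool_symbol (digits_value (\<sigma> i) < digits_value (\<sigma> j) \<or>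
         digits_value (\<sigma> i) = digits_value (\<sigma> j) \<and> b) # zs)) (3 * (length (\<sigma> i) + length (\<sigma> j)) + 1)"
  using assms(7)
proof (induction "length (\<sigma> i) + length (\<sigma> j)" arbitrary: \<sigma> b rule: less_induct)
  case less
  show ?case
  proof (cases "\<sigma> i = [] \<and> \<sigma> j = []")
    case True
    have "runs (While (\<lambda>r. r i \<noteq> None \<or> r j \<noteq> None) (compare_digit i j k)) \<sigma> \<sigma> 1"
      using True assms(1,2) by (intro runs_WhileF) (simp add: stacks_top_def)
    then show ?thesis by (rule runs_eq) (use True less.prems assms in \<open>auto simp: fun_eq_iff\<close>)
  next
    case False
    define x where "x \<longleftrightarrow> top_symbol (\<sigma> i) = Some One"
    define y where "y \<longleftrightarrow> top_symbol (\<sigma> j) = Some One"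
    define b' where "b' \<longleftrightarrow> (if x \<and> \<not> y then False else if \<not> x \<and> y then True else b)"
    let ?\<sigma> = "\<sigma>(i := tl (\<sigma> i), j := tl (\<sigma> j), k := bool_symbol b' # zs)"
    have 1: "runs (compare_digit i j k) \<sigma> ?\<sigma> 1"
      unfolding b'_def x_def y_def by (rule runs_compare_digit[of i j k \<sigma>, OF assms(1-6) less.prems])
    have sel: "?\<sigma> i = tl (\<sigma> i)" "?\<sigma> j = tl (\<sigma> j)" "?\<sigma> k = bool_symbol b' # zs"
      using assms by auto
    \<comment> \<open>A round removes at least one digit. The bound counts digits rather than
      rounds, which allows for one number being exhausted before the other.\<close>
    have len: "length (tl (\<sigma> i)) + length (tl (\<sigma> j)) + 1 \<le> length (\<sigma> i) + length (\<sigma> j)"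
      using False by (cases "\<sigma> i"; cases "\<sigma> j") auto
    have 2: "runs (While (\<lambda>r. r i \<noteq> None \<or> r j \<noteq> None) (compare_digit i j k)) ?\<sigma>
      (?\<sigma>(i := [], j := [], k := bool_symbol (digits_value (?\<sigma> i) < digits_value (?\<sigma> j) \<or>
         digits_value (?\<sigma> i) = digits_value (?\<sigma> j) \<and> b') # zs)) (3 * (length (?\<sigma> i) + length (?\<sigma> j)) + 1)"
      by (rule less.hyps) (use len sel in auto)
    have eq: "digits_value (tl (\<sigma> i)) < digits_value (tl (\<sigma> j)) \<or>
        digits_value (tl (\<sigma> i)) = digits_value (tl (\<sigma> j)) \<and> b' \<longleftrightarrow>
      digits_value (\<sigma> i) < digits_value (\<sigma> j) \<or> digits_value (\<sigma> i) = digits_value (\<sigma> j) \<and> b"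
      unfolding b'_def x_def y_def by (rule digits_value_le_step)
    have "runs (While (\<lambda>r. r i \<noteq> None \<or> r j \<noteq> None) (compare_digit i j k)) \<sigma>
      (?\<sigma>(i := [], j := [], k := bool_symbol (digits_value (?\<sigma> i) < digits_value (?\<sigma> j) \<or>
         digits_value (?\<sigma> i) = digits_value (?\<sigma> j) \<and> b') # zs))
      (1 + (3 * (length (?\<sigma> i) + length (?\<sigma> j)) + 1) + 2)"
      using False assms(1,2) by (intro runs_WhileT[OF _ 1 2]) (auto simp: stacks_top_def)
    then show ?thesis unfolding sel eq
      by (rule runs_eq) (use len in \<open>auto simp: fun_eq_iff\<close>)
  qed
qed

lemma runs_compare:
  assumes "i \<in> stack_idx" "j \<in> stack_idx" "k \<in> stack_idx" "i \<noteq> j" "i \<noteq> k" "j \<noteq> k"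
  shows "runs (compare i j k) \<sigma>
    (\<sigma>(i := [], j := [], k := bool_symbol (digits_value (\<sigma> i) \<le> digits_value (\<sigma> j)) # \<sigma> k))
    (3 * (length (\<sigma> i) + length (\<sigma> j)) + 3)"
  unfolding compare_def
proof (rule runs_eq[OF runs_Seq[OF runs_push runs_compare_loop[where b = True and zs = "\<sigma> k"]]])
qed (use assms in \<open>auto simp: fun_eq_iff le_less\<close>)

end

section \<open>Geodesic length\<close>

definition letters :: "'a set \<Rightarrow> 'a letter set" where
  "letters S = Gen ` S \<union> Inv ` S"

fun inv_letter :: "'a letter \<Rightarrow> 'a letter" where
  "inv_letter (Gen g) = Inv g"
| "inv_letter (Inv g) = Gen g"

lemma inv_letter_in: "x \<in> letters S \<Longrightarrow> inv_letter x \<in> letters S"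
  by (auto simp: letters_def)

lemma group_words_iff: "w \<in> group_words S \<longleftrightarrow> set w \<subseteq> letters S"
  by (auto simp: group_words_def letters_def)

definition geodesic_length :: "('a, 'b) monoid_scheme \<Rightarrow> 'a set \<Rightarrow> 'a letter list \<Rightarrow> nat" where
  "geodesic_length G S w =
     (LEAST n. \<exists>v\<in>group_words S. word_value G v = word_value G w \<and> length v = n)"

lemma geodesic_length_le:
  "v \<in> group_words S \<Longrightarrow> word_value G v = word_value G w \<Longrightarrow> geodesic_length G S w \<le> length v"
  unfolding geodesic_length_def by (rule Least_le) blast

lemma obtain_geodesic:
  assumes "w \<in> group_words S"
  obtains u where "u \<in> group_words S" "word_value G u = word_value G w" "length u = geodesic_length G S w"
proof -
  have "\<exists>v\<in>group_words S. word_value G v = word_value G w \<and> length v = geodesic_length G S w"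
    unfolding geodesic_length_def by (rule LeastI[of _ "length w"]) (use assms in blast)
  then show ?thesis using that by blast
qed

lemma geodesic_rep_iff:
  assumes "w \<in> group_words S"
  shows "geodesic_rep G S w u \<longleftrightarrow>
    u \<in> group_words S \<and> word_value G u = word_value G w \<and> length u = geodesic_length G S w"
proof -
  obtain v where v: "v \<in> group_words S" "word_value G v = word_value G w" "length v = geodesic_length G S w"
    using obtain_geodesic[OF assms] .
  have "\<not> length x < length u"
    if "length u = geodesic_length G S w" "x \<in> group_words S" "word_value G x = word_value G w" for x
    using geodesic_length_le[OF that(2,3)] that(1) by simp
  moreover have "length u = geodesic_length G S w"
    if "geodesic_rep G S w u"
    using that v geodesic_length_le[of u S G w] unfolding geodesic_rep_def is_arg_min_def
    by (metis le_neq_implies_less)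
  ultimately show ?thesis
    unfolding geodesic_rep_def is_arg_min_def by blast
qed

lemma geodesic_length_word_le: "w \<in> group_words S \<Longrightarrow> geodesic_length G S w \<le> length w"
  by (rule geodesic_length_le) simp_all

lemma word_problem_memI:
  assumes "w \<in> group_words S"
  shows "u \<in> group_words S \<Longrightarrow> word_value G u = word_value G w \<Longrightarrow> length u = geodesic_length G S w \<Longrightarrow>
      (encode_word w, encode_word u) \<in> geodesic_problem G S"
    and "(encode_word w, encode_nat (geodesic_length G S w)) \<in> geodesic_length_problem G S"
    and "(encode_word w @ Comma # encode_int k, encode_bool (int (geodesic_length G S w) \<le> k))
      \<in> bounded_geodesic_length_problem G S"
proof -
  obtain v where v: "geodesic_rep G S w v" "length v = geodesic_length G S w"
    using obtain_geodesic[OF assms] geodesic_rep_iff[OF assms] by metis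
  show "(encode_word w, encode_word u) \<in> geodesic_problem G S"
    if "u \<in> group_words S" "word_value G u = word_value G w" "length u = geodesic_length G S w"
    using that assms geodesic_rep_iff[OF assms] by (auto simp: geodesic_problem_def)
  show "(encode_word w, encode_nat (geodesic_length G S w)) \<in> geodesic_length_problem G S"
    unfolding geodesic_length_problem_def mem_Collect_eq
    by (intro exI[of _ w] exI[of _ v]) (use v assms in simp)
  show "(encode_word w @ Comma # encode_int k, encode_bool (int (geodesic_length G S w) \<le> k))
      \<in> bounded_geodesic_length_problem G S"
    unfolding bounded_geodesic_length_problem_def mem_Collect_eq
    by (intro exI[of _ w] exI[of _ k] exI[of _ v]) (use v assms in simp)
qed

lemma inj_encode_word: "encode_word v = encode_word w \<Longrightarrow> v = w"
  by (simp add: encode_word_def inj_map_eq_map inj_def)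

text \<open>No letter is encoded as \<open>Comma\<close>, so its first occurrence marks the end of
  the word.\<close>

lemma encode_word_Comma_inject:
  "encode_word v @ Comma # xs = encode_word w @ Comma # ys \<Longrightarrow> v = w \<and> xs = ys"
  by (induction v w rule: list_induct2') (auto simp: encode_word_def)

lemma length_encode_word [simp]: "length (encode_word w) = length w"
  by (simp add: encode_word_def)

lemma geodesic_problem_cases:
  assumes "(y, z) \<in> geodesic_problem G S"
  obtains w u where "y = encode_word w" "z = encode_word u" "w \<in> group_words S" "u \<in> group_words S"
    "word_value G u = word_value G w" "length u = geodesic_length G S w"
  using assms geodesic_rep_iff[of _ S G] by (auto simp: geodesic_problem_def)

lemma geodesic_length_problem_cases:
  assumes "(y, z) \<in> geodesic_length_problem G S"
  obtains w where "y = encode_word w" "w \<in> group_words S" "z = encode_nat (geodesic_length G S w)"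
  using assms geodesic_rep_iff[of _ S G] by (auto simp: geodesic_length_problem_def)

lemma bounded_geodesic_length_problem_cases:
  assumes "(y, z) \<in> bounded_geodesic_length_problem G S"
  obtains w k where "y = encode_word w @ Comma # encode_int k" "w \<in> group_words S"
    "z = encode_bool (int (geodesic_length G S w) \<le> k)"
  using assms geodesic_rep_iff[of _ S G] by (auto simp: bounded_geodesic_length_problem_def)

definition symbols :: "'a set \<Rightarrow> 'a symbol set" where
  "symbols S = Letter ` letters S \<union> {Zero, One, Minus, Comma}"

lemma set_encode_word: "w \<in> group_words S \<Longrightarrow> set (encode_word w) \<subseteq> symbols S"
  by (auto simp: encode_word_def symbols_def group_words_iff)

lemma set_encode_nat_symbols: "set (encode_nat n) \<subseteq> symbols S"
  using set_encode_nat[of n] by (auto simp: symbols_def)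

lemma set_encode_int_symbols: "set (encode_int n) \<subseteq> symbols S"
  using set_encode_nat_symbols[of _ S] by (auto simp: encode_int_def symbols_def)

section \<open>Geodesic length under multiplication by a letter\<close>

context group
begin

lemma word_value_closed: "S \<subseteq> carrier G \<Longrightarrow> w \<in> group_words S \<Longrightarrow> word_value G w \<in> carrier G"
proof (induction w)
  case (Cons x w)
  then show ?case by (cases x) (auto simp: group_words_iff letters_def)
qed simp

lemma word_value_append:
  assumes "S \<subseteq> carrier G" "v \<in> group_words S" "w \<in> group_words S"
  shows "word_value G (v @ w) = word_value G v \<otimes> word_value G w"
  using assms(2)
proof (induction v)
  case (Cons x v)
  then have "v \<in> group_words S" "x \<in> letters S" by (auto simp: group_words_iff)
  then show ?case using Cons.IH assms word_value_closed[OF assms(1), of v] word_value_closed[OF assms(1), of w]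
    by (cases x) (auto simp: letters_def m_assoc subset_iff)
qed (use assms word_value_closed in auto)

text \<open>The programs never reduce words; multiplication by an inverse letter is done by
  prepending it, and cancellation takes place in the value only.\<close>

lemma word_value_cancel:
  assumes "S \<subseteq> carrier G" "x \<in> letters S" "v \<in> group_words S"
  shows "word_value G (inv_letter x # x # v) = word_value G v"
    and "word_value G (x # inv_letter x # v) = word_value G v"
  using assms word_value_closed[OF assms(1,3)]
  by (cases x; auto simp: letters_def subset_iff simp flip: m_assoc)+

lemma word_value_Cons_cong:
  "word_value G u = word_value G v \<Longrightarrow> word_value G (x # u) = word_value G (x # v)"
  by (cases x) auto

text \<open>Prefixing \<open>x\<close> to a geodesic of the shortened element gives a word for
  \<open>v\<close>. So one letter can lower the geodesic length by at most one.\<close>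

lemma geodesic_length_le_Suc:
  assumes "S \<subseteq> carrier G" "x \<in> letters S" "v \<in> group_words S"
  shows "geodesic_length G S v \<le> Suc (geodesic_length G S (inv_letter x # v))"
proof -
  have "inv_letter x # v \<in> group_words S"
    using assms inv_letter_in by (auto simp: group_words_iff)
  then obtain u where u: "u \<in> group_words S" "word_value G u = word_value G (inv_letter x # v)"
    "length u = geodesic_length G S (inv_letter x # v)"
    by (rule obtain_geodesic)
  have "word_value G (x # u) = word_value G (x # inv_letter x # v)"
    using u(2) by (rule word_value_Cons_cong)
  then have "word_value G (x # u) = word_value G v"
    using word_value_cancel(2)[OF assms] by simp
  moreover have "x # u \<in> group_words S" using u(1) assms by (auto simp: group_words_iff)
  ultimately have "geodesic_length G S v \<le> length (x # u)" by (intro geodesic_length_le)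
  then show ?thesis using u(3) by simp
qed

text \<open>The first letter of any geodesic for \<open>v\<close> is a witness: the rest of that
  geodesic represents the new element.\<close>

lemma ex_geodesic_length_less:
  assumes "S \<subseteq> carrier G" "v \<in> group_words S" "0 < geodesic_length G S v"
  shows "\<exists>x\<in>letters S. geodesic_length G S (inv_letter x # v) < geodesic_length G S v"
proof -
  obtain u where u: "u \<in> group_words S" "word_value G u = word_value G v" "length u = geodesic_length G S v"
    using assms(2) by (rule obtain_geodesic)
  then obtain x u' where xu: "u = x # u'" using assms(3) by (cases u) auto
  then have x: "x \<in> letters S" "u' \<in> group_words S" using u by (auto simp: group_words_iff)
  have "word_value G u' = word_value G (inv_letter x # v)"
    using word_value_cancel(1)[OF assms(1) x] word_value_Cons_cong[OF u(2), of "inv_letter x"] xu by simp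
  then have "geodesic_length G S (inv_letter x # v) \<le> length u'"
    using x by (intro geodesic_length_le)
  then show ?thesis using x u(3) xu by (intro bexI[of _ x]) simp_all
qed

lemma geodesic_length_0:
  assumes "S \<subseteq> carrier G" "v \<in> group_words S" "geodesic_length G S v = 0"
  shows "word_value G v = \<one>"
  using obtain_geodesic[OF assms(2), of G] assms(3) by (metis length_0_conv word_value.simps(1))

end

section \<open>The queries\<close>

text \<open>
  The common interface of the three subroutines: given a word on stack 3 and a number \<open>k\<close> on stack 4,
  push on stack 2 whether the geodesic length of the word is at most \<open>k\<close>. Stack 5 is reserved for the
  geodesic found so far, and the other stacks are scratch.
\<close>

definition query_bounded :: "'a symbol com" where
  "query_bounded = (move_all 4 2 6 ;; push 2 Comma ;; copy 3 2 7 ;; move_all 6 4 4) ;; call"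

definition query_length :: "'a symbol com" where
  "query_length = copy 3 2 7 ;; call ;; move_all 2 6 6 ;; copy 4 7 8 ;; compare 6 7 2"

text \<open>The answer is used only through its length: each returned symbol is discarded and
  increments the counter on stack 6.\<close>

definition query_geodesic :: "'a symbol com" where
  "query_geodesic = copy 3 2 7 ;; call ;; push 6 Zero ;;
     while_nonempty 2 (pop 2 ;; incr 6 7) ;; copy 4 7 8 ;; compare 6 7 2"

text \<open>All other stacks are empty between queries; copying, incrementing and calling rely on
  this for their scratch space.\<close>

definition search_state :: "'a symbol list \<Rightarrow> 'a letter list \<Rightarrow> nat \<Rightarrow> 'a letter list \<Rightarrow> 'a symbol stacks" where
  "search_state q v k u = (\<lambda>_. [])(2 := q, 3 := encode_word v, 4 := digits k, 5 := encode_word u)"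

locale geodesic_setting = group G for G :: "('a, 'b) monoid_scheme" (structure) +
  fixes S :: "'a set"
  assumes finite_gens: "finite S" and gens: "S \<subseteq> carrier G"

locale geodesic_calls = geodesic_setting G S + digit_routines "symbols S" f D
  for G :: "('a, 'b) monoid_scheme" (structure) and S f D
begin

abbreviation glen :: "'a letter list \<Rightarrow> nat" where
  "glen \<equiv> geodesic_length G S"

text \<open>A common time bound for the three interfaces. The square comes from counting a returned
  geodesic: linearly many increments, each estimated by a linear bound.\<close>

definition decides :: "'a symbol com \<Rightarrow> bool" where
  "decides Q \<longleftrightarrow> (\<forall>v k u. v \<in> group_words S \<longrightarrow>
     runs Q (search_state [] v k u) (search_state [bool_symbol (glen v \<le> k)] v k u)
       (100 * (length v + length (digits k :: 'a symbol list) + 1)\<^sup>2))"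

lemma Comma_in: "Comma \<in> symbols S"
  by (simp add: symbols_def)

end

lemma linear_le_square: "a * n + b \<le> 100 * (n + 1)\<^sup>2" if "a \<le> 100" "b \<le> 100" for n a b :: nat
proof -
  have "a * n + b \<le> 100 * n + 100" using that by (intro add_mono mult_right_mono) auto
  also have "\<dots> \<le> 100 * (n + 1)\<^sup>2" by (simp add: power2_eq_square)
  finally show ?thesis .
qed

context geodesic_calls
begin

text \<open>The question is built on stack 2 from its end: unloading the counter puts its most
  significant digit on top, then come \<open>Comma\<close> and the word. The copy of the counter on
  stack 6 serves to restore stack 4.\<close>

lemma decides_query_bounded:
  assumes "\<And>v k. v \<in> group_words S \<Longrightarrow> encode_word v @ Comma # encode_nat k \<in> D"
    and "\<And>v k. v \<in> group_words S \<Longrightarrow> f (encode_word v @ Comma # encode_nat k) = [bool_symbol (glen v \<le> k)]"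
  shows "decides query_bounded"
  unfolding decides_def
proof (intro allI impI)
  fix v k u assume v: "v \<in> group_words S"
  let ?n = "length v + length (digits k :: 'a symbol list)"
  let ?\<sigma> = "(search_state [] v k u)(2 := encode_word v @ Comma # encode_nat k)"
  have 1: "runs (move_all 4 2 6 ;; push 2 Comma ;; copy 3 2 7 ;; move_all 6 4 4) (search_state [] v k u) ?\<sigma>
     (20 * ?n + 10)"
    by (rule runs_eq[OF runs_Seq[OF runs_move_all runs_Seq[OF runs_push runs_Seq[OF runs_copy runs_move_all]]]])
      (auto simp: Comma_in search_state_def fun_eq_iff digits_def)
  have 2: "runs call ?\<sigma> (search_state [bool_symbol (glen v \<le> k)] v k u) (3 * ?n + 20)"
    by (rule runs_eq[OF runs_call])
      (use assms[OF v] in \<open>auto simp: search_state_def fun_eq_iff digits_def\<close>)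
  show "runs query_bounded (search_state [] v k u) (search_state [bool_symbol (glen v \<le> k)] v k u)
       (100 * (?n + 1)\<^sup>2)"
    unfolding query_bounded_def
    by (rule runs_mono[OF runs_Seq[OF 1 2]]) (use linear_le_square[of 23 30 ?n] in simp)
qed

lemma decides_query_length:
  assumes "\<And>v. v \<in> group_words S \<Longrightarrow> encode_word v \<in> D"
    and "\<And>v. v \<in> group_words S \<Longrightarrow> f (encode_word v) = encode_nat (glen v)"
  shows "decides query_length"
  unfolding decides_def
proof (intro allI impI)
  fix v k u assume v: "v \<in> group_words S"
  let ?n = "length v + length (digits k :: 'a symbol list)"
  have len: "length (encode_nat (glen v) :: 'a symbol list) \<le> Suc (length v)"
    using length_encode_nat_le[of "glen v"] geodesic_length_word_le[OF v, of G] by (meson Suc_le_mono le_trans)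
  have len': "length (digits (glen v) :: 'a symbol list) \<le> Suc (length v)"
    using len by (simp add: digits_def)
  have "runs query_length (search_state [] v k u) (search_state [bool_symbol (glen v \<le> k)] v k u)
      (30 * ?n + 40)"
    unfolding query_length_def
    by (rule runs_eq[OF runs_Seq[OF runs_copy runs_Seq[OF runs_call runs_Seq[OF runs_move_all
        runs_Seq[OF runs_copy runs_compare]]]]])
      (use assms[OF v] len len' in \<open>simp_all add: search_state_def fun_eq_iff flip: digits_def\<close>)
  then show "runs query_length (search_state [] v k u) (search_state [bool_symbol (glen v \<le> k)] v k u)
       (100 * (?n + 1)\<^sup>2)"
    by (rule runs_mono) (use linear_le_square[of 30 40 ?n] in simp)
qed

text \<open>The number of digits is estimated by the number itself plus one; this rough bound
  suffices and keeps the sum over the increments quadratic.\<close>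

lemma runs_count:
  assumes "\<sigma> 7 = []" and "\<sigma> 6 = digits m"
  shows "runs (while_nonempty 2 (pop 2 ;; incr 6 7)) \<sigma>
    (\<sigma>(2 := [], 6 := digits (m + length (\<sigma> 2)))) (length (\<sigma> 2) * (9 * (m + length (\<sigma> 2)) + 17) + 1)"
  using assms
proof (induction "\<sigma> 2" arbitrary: \<sigma> m)
  case Nil
  have "runs (while_nonempty 2 (pop 2 ;; incr 6 7)) \<sigma> \<sigma> 1"
    using Nil(1) by (intro runs_while_nonemptyF) auto
  then show ?case by (rule runs_eq) (use Nil in \<open>simp_all add: fun_eq_iff\<close>)
next
  case (Cons x xs)
  let ?\<sigma> = "\<sigma>(2 := xs, 6 := digits (Suc m))"
  have \<sigma>2: "\<sigma> 2 = x # xs" using Cons by simp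
  have len: "length (digits m :: 'a symbol list) \<le> Suc m" by (rule length_digits_le)
  have 1: "runs (pop 2 ;; incr 6 7) \<sigma> ?\<sigma> (9 * m + 15)"
    by (rule runs_eq[OF runs_Seq[OF runs_pop runs_incr]])
      (use Cons.prems \<sigma>2 len in \<open>auto simp: fun_eq_iff inc_digits_digits\<close>)
  have 2: "runs (while_nonempty 2 (pop 2 ;; incr 6 7)) ?\<sigma>
      (?\<sigma>(2 := [], 6 := digits (Suc m + length (?\<sigma> 2)))) (length (?\<sigma> 2) * (9 * (Suc m + length (?\<sigma> 2)) + 17) + 1)"
    using Cons.prems by (intro Cons.hyps(1)) auto
  have "runs (while_nonempty 2 (pop 2 ;; incr 6 7)) \<sigma>
      (?\<sigma>(2 := [], 6 := digits (Suc m + length (?\<sigma> 2))))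
      (9 * m + 15 + (length (?\<sigma> 2) * (9 * (Suc m + length (?\<sigma> 2)) + 17) + 1) + 2)"
    by (rule runs_while_nonemptyT[OF _ _ 1 2]) (simp_all add: \<sigma>2)
  then show ?case
    by (rule runs_eq) (use \<sigma>2 in \<open>simp_all add: fun_eq_iff algebra_simps\<close>)
qed

lemma decides_query_geodesic:
  assumes "\<And>v. v \<in> group_words S \<Longrightarrow> encode_word v \<in> D"
    and "\<And>v. v \<in> group_words S \<Longrightarrow> length (f (encode_word v)) = glen v"
  shows "decides query_geodesic"
  unfolding decides_def
proof (intro allI impI)
  fix v k u assume v: "v \<in> group_words S"
  let ?n = "length v + length (digits k :: 'a symbol list)"
  have len: "glen v \<le> length v"
    using geodesic_length_word_le[OF v] .
  have len': "length (digits (glen v) :: 'a symbol list) \<le> Suc (length v)"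
    using length_digits_le len by (meson Suc_le_mono le_trans)
  have loop: "glen v * (9 * glen v + 17) \<le> ?n * (9 * ?n + 17)"
    using len by (intro mult_mono) auto
  have "runs query_geodesic (search_state [] v k u) (search_state [bool_symbol (glen v \<le> k)] v k u)
      (?n * (9 * ?n + 17) + (40 * ?n + 40))"
    unfolding query_geodesic_def
    by (rule runs_eq[OF runs_Seq[OF runs_copy runs_Seq[OF runs_call runs_Seq[OF runs_push
        runs_Seq[OF runs_count[where m = 0] runs_Seq[OF runs_copy runs_compare]]]]]])
      (use assms[OF v] len len' loop in \<open>simp_all add: search_state_def fun_eq_iff\<close>)
  then show "runs query_geodesic (search_state [] v k u) (search_state [bool_symbol (glen v \<le> k)] v k u)
       (100 * (?n + 1)\<^sup>2)"
    by (rule runs_mono) (simp add: power2_eq_square algebra_simps)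
qed

end

section \<open>Solving the problems by queries\<close>

definition length_program :: "'a symbol com \<Rightarrow> 'a symbol com" where
  "length_program Q =
     push 4 Zero ;; Q ;; while_top 2 Zero (pop 2 ;; incr 4 6 ;; Q) ;; pop 2 ;; move_all 4 2 2"

text \<open>Lengths are nonnegative, so a minus sign settles the answer; the query interface only
  takes natural bounds. The word waits reversed on stack 6 while the number moves to stack 4, which
  puts its least significant digit on top; then the word is unloaded back.\<close>

definition bounded_program :: "'a symbol com \<Rightarrow> 'a symbol com" where
  "bounded_program Q =
     While (\<lambda>r. r 3 \<noteq> Some Comma) (move_top 3 6 6) ;; pop 3 ;;
     if_top 3 Minus (push 2 Zero) (move_all 3 4 4 ;; move_all 6 3 3 ;; Q)"

text \<open>The recursion unrolls when the program is built: letters are hard-wired, and the program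
  size depends on the alphabet but not on the input. On success the longer word stays on stack 3 and
  the letter is recorded; on failure the trial letter is removed again.\<close>

fun attempt :: "'a symbol com \<Rightarrow> 'a letter list \<Rightarrow> 'a symbol com" where
  "attempt Q [] = push 2 Zero"
| "attempt Q (x # xs) =
     push 3 (Letter (inv_letter x)) ;; Q ;;
     if_top 2 One (push 5 (Letter x)) (pop 2 ;; pop 3 ;; attempt Q xs)"

text \<open>
  The least \<open>k\<close> such that some \<open>inv_letter x # v\<close> has geodesic length at most \<open>k\<close> is one less than the
  geodesic length of \<open>v\<close>. Counting up to it from 0 avoids subtraction, hence stripping leading zeros.
\<close>

definition search :: "'a symbol com \<Rightarrow> 'a letter list \<Rightarrow> 'a symbol com" where
  "search Q xs = attempt Q xs ;; while_top 2 Zero (pop 2 ;; incr 4 6 ;; attempt Q xs)"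

text \<open>With 0 on stack 4 the query asks whether the remaining word is trivial in the group.
  Letters are pushed on stack 5 in order of discovery, so the final unloading puts the first one on
  top.\<close>

definition geodesic_program :: "'a symbol com \<Rightarrow> 'a letter list \<Rightarrow> 'a symbol com" where
  "geodesic_program Q xs =
     push 4 Zero ;; Q ;;
     while_top 2 Zero (pop 2 ;; search Q xs ;; (pop 2 ;; clear 4 ;; push 4 Zero) ;; Q) ;;
     pop 2 ;; move_all 5 2 2"

abbreviation query_time :: "nat \<Rightarrow> nat" where
  "query_time n \<equiv> 100 * (n + 1)\<^sup>2"

text \<open>The size \<open>2 * m + 1\<close> is the word of length \<open>m\<close> plus at most
  \<open>m + 1\<close> digits of a counter that never exceeds \<open>m\<close>.\<close>

definition length_time :: "nat \<Rightarrow> nat" where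
  "length_time m = m * (query_time (2 * m + 1) + 9 * (2 * m + 1) + 10) + query_time (2 * m + 1) + 4 * m + 10"

definition bounded_time :: "nat \<Rightarrow> nat" where
  "bounded_time m = query_time m + 12 * m + 20"

definition attempt_time :: "nat \<Rightarrow> nat \<Rightarrow> nat" where
  "attempt_time l n = l * (query_time n + 10) + 2"

definition search_time :: "nat \<Rightarrow> nat \<Rightarrow> nat" where
  "search_time l n = attempt_time l n + n * (attempt_time l n + 9 * n + 10) + 1"

definition round_time :: "nat \<Rightarrow> nat \<Rightarrow> nat" where
  "round_time l n = search_time l n + query_time n + 3 * n + 20"

text \<open>There are at most \<open>m\<close> rounds. The question size \<open>2 * m + 1\<close>
  serves for all of them, because word length plus geodesic length is constant from round to round
  and at most \<open>2 * m\<close> at the start.\<close>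

definition geodesic_time :: "nat \<Rightarrow> nat \<Rightarrow> nat" where
  "geodesic_time l m = m * round_time l (2 * m + 1) + query_time (2 * m + 1) + 4 * m + 10"

section \<open>Correctness of the length and bounded length programs\<close>

context geodesic_calls
begin

lemma Letter_in: "x \<in> letters S \<Longrightarrow> Letter x \<in> symbols S"
  by (simp add: symbols_def)

lemma runs_query:
  assumes "decides Q" and "v \<in> group_words S" and "length v + length (digits k :: 'a symbol list) \<le> n"
  shows "runs Q (search_state [] v k u) (search_state [bool_symbol (glen v \<le> k)] v k u) (query_time n)"
proof -
  have "runs Q (search_state [] v k u) (search_state [bool_symbol (glen v \<le> k)] v k u)
      (query_time (length v + length (digits k :: 'a symbol list)))"
    using assms by (simp add: decides_def)
  then show ?thesis by (rule runs_mono) (use assms(3) in \<open>simp add: power_mono\<close>)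
qed

lemma digits_length_bound: "k < m \<Longrightarrow> length (digits k :: 'a symbol list) \<le> m"
  using length_digits_le[of k] by (meson Suc_leI le_trans)

lemma runs_length_loop:
  assumes Q: "decides Q" and v: "v \<in> group_words S" and k: "k \<le> glen v" and n: "length v + glen v + 1 \<le> n"
  shows "runs (while_top 2 Zero (pop 2 ;; incr 4 6 ;; Q)) (search_state [bool_symbol (glen v \<le> k)] v k u)
    (search_state [One] v (glen v) u) ((glen v - k) * (query_time n + 9 * n + 10) + 1)"
  using k
proof (induction "glen v - k" arbitrary: k)
  case 0
  then have "k = glen v" by simp
  moreover have "runs (while_top 2 Zero (pop 2 ;; incr 4 6 ;; Q)) (search_state [One] v (glen v) u)
      (search_state [One] v (glen v) u) 1"
    by (rule runs_while_topF) (auto simp: search_state_def)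
  ultimately show ?case by simp
next
  case (Suc d)
  then have k: "k < glen v" by simp
  \<comment> \<open>The counter \<open>Suc k\<close> may reach \<open>glen v\<close>, and a number
    \<open>i\<close> has at most \<open>i + 1\<close> digits; this accounts for the
    \<open>+ 1\<close> in the hypothesis on \<open>n\<close>.\<close>
  have len: "length (digits k :: 'a symbol list) \<le> n" "length v + length (digits (Suc k) :: 'a symbol list) \<le> n"
    using digits_length_bound[OF k] digits_length_bound[of "Suc k" "Suc (glen v)"] k n by auto
  have 1: "runs (pop 2 ;; incr 4 6) (search_state [bool_symbol (glen v \<le> k)] v k u) (search_state [] v (Suc k) u) (9 * n + 6)"
    by (rule runs_eq[OF runs_Seq[OF runs_pop runs_incr]])
      (use len in \<open>auto simp: search_state_def fun_eq_iff inc_digits_digits\<close>)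
  have "runs (while_top 2 Zero (pop 2 ;; incr 4 6 ;; Q)) (search_state [bool_symbol (glen v \<le> k)] v k u)
    (search_state [One] v (glen v) u)
    ((9 * n + 6 + query_time n) + ((glen v - Suc k) * (query_time n + 9 * n + 10) + 1) + 2)"
  proof (rule runs_while_topT)
    show "runs (pop 2 ;; incr 4 6 ;; Q) (search_state [bool_symbol (glen v \<le> k)] v k u)
        (search_state [bool_symbol (glen v \<le> Suc k)] v (Suc k) u) (9 * n + 6 + query_time n)"
      using runs_Seq_assoc[OF runs_Seq[OF 1 runs_query[OF Q v len(2)]]] .
    show "runs (while_top 2 Zero (pop 2 ;; incr 4 6 ;; Q)) (search_state [bool_symbol (glen v \<le> Suc k)] v (Suc k) u)
        (search_state [One] v (glen v) u) ((glen v - Suc k) * (query_time n + 9 * n + 10) + 1)"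
      using Suc by (intro Suc.hyps(1)) auto
  qed (use k in \<open>auto simp: search_state_def\<close>)
  moreover have "glen v - k = Suc (glen v - Suc k)" using k by simp
  ultimately show ?case by (simp add: runs_mono)
qed

definition solved_by :: "'a symbol problem \<Rightarrow> 'a symbol com \<Rightarrow> (nat \<Rightarrow> nat) \<Rightarrow> bool" where
  "solved_by A c t \<longleftrightarrow>
     (\<forall>x\<in>Domain A. \<exists>\<sigma>. (x, \<sigma> 2) \<in> A \<and> runs c ((\<lambda>_. [])(3 := x)) \<sigma> (t (length x)))"

lemma solved_by_length_program:
  assumes Q: "decides Q"
  shows "solved_by (geodesic_length_problem G S) (length_program Q) length_time"
  unfolding solved_by_def
proof
  fix x assume "x \<in> Domain (geodesic_length_problem G S)"
  then obtain w where w: "w \<in> group_words S" and x: "x = encode_word w"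
    by (auto elim: geodesic_length_problem_cases)
  let ?n = "2 * length w + 1"
  let ?\<sigma> = "(search_state [] w (glen w) [])(2 := encode_nat (glen w), 4 := [])"
  have glen: "glen w \<le> length w" using w by (rule geodesic_length_word_le)
  have 1: "runs (push 4 Zero) ((\<lambda>_. [])(3 := x)) (search_state [] w 0 []) 2"
    by (rule runs_eq[OF runs_push]) (auto simp: x search_state_def fun_eq_iff encode_word_def)
  have 2: "runs Q (search_state [] w 0 []) (search_state [bool_symbol (glen w \<le> 0)] w 0 []) (query_time ?n)"
    by (rule runs_query[OF Q w]) simp
  have 3: "runs (while_top 2 Zero (pop 2 ;; incr 4 6 ;; Q)) (search_state [bool_symbol (glen w \<le> 0)] w 0 [])
      (search_state [One] w (glen w) []) (length w * (query_time ?n + 9 * ?n + 10) + 1)"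
  proof (rule runs_mono[OF runs_length_loop[OF Q w, where n = ?n]])
    show "(glen w - 0) * (query_time ?n + 9 * ?n + 10) + 1 \<le> length w * (query_time ?n + 9 * ?n + 10) + 1"
      using glen by (intro add_mono mult_right_mono) auto
  qed (use glen in auto)
  have 4: "runs (pop 2 ;; move_all 4 2 2) (search_state [One] w (glen w) []) ?\<sigma> (4 * length w + 6)"
    by (rule runs_eq[OF runs_Seq[OF runs_pop runs_move_all]])
      (use digits_length_bound[of "glen w" "Suc (length w)"] glen in
        \<open>auto simp: search_state_def fun_eq_iff digits_def\<close>)
  have "runs (length_program Q) ((\<lambda>_. [])(3 := x)) ?\<sigma> (length_time (length x))"
    unfolding length_program_def
    by (rule runs_mono[OF runs_Seq[OF 1 runs_Seq[OF 2 runs_Seq[OF 3 4]]]]) (simp add: length_time_def x)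
  moreover have "(x, ?\<sigma> 2) \<in> geodesic_length_problem G S"
    using word_problem_memI(2)[OF w] by (simp add: x)
  ultimately show "\<exists>\<sigma>. (x, \<sigma> 2) \<in> geodesic_length_problem G S \<and>
      runs (length_program Q) ((\<lambda>_. [])(3 := x)) \<sigma> (length_time (length x))"
    by blast
qed

lemma runs_move_word:
  assumes "\<sigma> 3 = encode_word w @ Comma # xs"
  shows "runs (While (\<lambda>r. r 3 \<noteq> Some Comma) (move_top 3 6 6)) \<sigma>
    (\<sigma>(3 := Comma # xs, 6 := rev (encode_word w) @ \<sigma> 6)) (4 * length w + 1)"
  using assms
proof (induction w arbitrary: \<sigma>)
  case Nil
  have "runs (While (\<lambda>r. r 3 \<noteq> Some Comma) (move_top 3 6 6)) \<sigma> \<sigma> 1"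
    by (rule runs_WhileF) (use Nil in \<open>auto simp: stacks_top_def encode_word_def\<close>)
  then show ?case by (rule runs_eq) (use Nil in \<open>auto simp: fun_eq_iff encode_word_def\<close>)
next
  case (Cons x w)
  let ?\<sigma> = "\<sigma>(3 := encode_word w @ Comma # xs, 6 := Letter x # \<sigma> 6, 6 := Letter x # \<sigma> 6)"
  have \<sigma>3: "\<sigma> 3 = Letter x # (encode_word w @ Comma # xs)" using Cons.prems by (simp add: encode_word_def)
  have "runs (While (\<lambda>r. r 3 \<noteq> Some Comma) (move_top 3 6 6)) \<sigma>
    (?\<sigma>(3 := Comma # xs, 6 := rev (encode_word w) @ ?\<sigma> 6)) (2 + (4 * length w + 1) + 2)"
  proof (rule runs_WhileT)
    show "runs (move_top 3 6 6) \<sigma> ?\<sigma> 2"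
      by (rule runs_move_top) (use \<sigma>3 in auto)
    show "runs (While (\<lambda>r. r 3 \<noteq> Some Comma) (move_top 3 6 6)) ?\<sigma>
        (?\<sigma>(3 := Comma # xs, 6 := rev (encode_word w) @ ?\<sigma> 6)) (4 * length w + 1)"
      by (rule Cons.IH) simp
  qed (use \<sigma>3 in \<open>auto simp: stacks_top_def\<close>)
  then show ?case by (rule runs_eq) (auto simp: fun_eq_iff encode_word_def)
qed

lemma solved_by_bounded_program:
  assumes Q: "decides Q"
  shows "solved_by (bounded_geodesic_length_problem G S) (bounded_program Q) bounded_time"
  unfolding solved_by_def
proof
  fix x assume "x \<in> Domain (bounded_geodesic_length_problem G S)"
  then obtain w k where w: "w \<in> group_words S" and x: "x = encode_word w @ Comma # encode_int k"
    by (auto elim: bounded_geodesic_length_problem_cases)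
  let ?\<sigma>1 = "(\<lambda>_. [])(3 := encode_int k, 6 := rev (encode_word w)) :: 'a symbol stacks"
  have 1: "runs (While (\<lambda>r. r 3 \<noteq> Some Comma) (move_top 3 6 6)) ((\<lambda>_. [])(3 := x))
      ((\<lambda>_. [])(3 := Comma # encode_int k, 6 := rev (encode_word w))) (4 * length w + 1)"
    by (rule runs_eq[OF runs_move_word]) (auto simp: x fun_eq_iff)
  have 2: "runs (pop 3) ((\<lambda>_. [])(3 := Comma # encode_int k, 6 := rev (encode_word w))) ?\<sigma>1 1"
    by (rule runs_eq[OF runs_pop]) (auto simp: fun_eq_iff)
  have "\<exists>\<sigma>. \<sigma> 2 = [bool_symbol (int (glen w) \<le> k)] \<and>
    runs (if_top 3 Minus (push 2 Zero) (move_all 3 4 4 ;; move_all 6 3 3 ;; Q)) ?\<sigma>1 \<sigma>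
      (query_time (length x) + 4 * length x + 10)"
  proof (cases "k < 0")
    case True
    have "runs (if_top 3 Minus (push 2 Zero) (move_all 3 4 4 ;; move_all 6 3 3 ;; Q)) ?\<sigma>1 (?\<sigma>1(2 := Zero # ?\<sigma>1 2)) (2 + 2)"
      using True by (intro runs_if_topT runs_push) (auto simp: encode_int_def)
    then have "runs (if_top 3 Minus (push 2 Zero) (move_all 3 4 4 ;; move_all 6 3 3 ;; Q)) ?\<sigma>1 (?\<sigma>1(2 := Zero # ?\<sigma>1 2))
        (query_time (length x) + 4 * length x + 10)"
      by (rule runs_mono) simp
    then show ?thesis using True by (intro exI[of _ "?\<sigma>1(2 := Zero # ?\<sigma>1 2)"]) auto
  next
    case False
    define m where "m = nat k"
    have k: "k = int m" and enc: "encode_int k = encode_nat m"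
      using False by (simp_all add: m_def encode_int_def)
    have len: "length x = length w + length (digits m :: 'a symbol list) + 1"
      by (simp add: x enc digits_def)
    have a: "runs (move_all 3 4 4 ;; move_all 6 3 3) ?\<sigma>1 (search_state [] w m []) (4 * length x + 2)"
      by (rule runs_eq[OF runs_Seq[OF runs_move_all runs_move_all]])
        (auto simp: search_state_def fun_eq_iff enc digits_def x encode_word_def)
    have b: "runs Q (search_state [] w m []) (search_state [bool_symbol (glen w \<le> m)] w m []) (query_time (length x))"
      using len by (intro runs_query Q w) simp
    have top: "top_symbol (?\<sigma>1 3) \<noteq> Some Minus"
      using set_encode_nat[of m, where 'a = 'a] by (cases "encode_nat m :: 'a symbol list") (auto simp: enc)
    have "runs (if_top 3 Minus (push 2 Zero) (move_all 3 4 4 ;; move_all 6 3 3 ;; Q)) ?\<sigma>1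
      (search_state [bool_symbol (glen w \<le> m)] w m []) (query_time (length x) + 4 * length x + 10)"
      by (rule runs_mono[OF runs_if_topF[OF _ top runs_Seq_assoc[OF runs_Seq[OF a b]]]]) auto
    then show ?thesis by (intro exI[of _ "search_state [bool_symbol (glen w \<le> m)] w m []"]) (simp add: k search_state_def)
  qed
  then obtain \<sigma> where \<sigma>: "\<sigma> 2 = [bool_symbol (int (glen w) \<le> k)]"
    and 3: "runs (if_top 3 Minus (push 2 Zero) (move_all 3 4 4 ;; move_all 6 3 3 ;; Q)) ?\<sigma>1 \<sigma>
      (query_time (length x) + 4 * length x + 10)"
    by blast
  have "runs (bounded_program Q) ((\<lambda>_. [])(3 := x)) \<sigma> (bounded_time (length x))"
    unfolding bounded_program_def
    by (rule runs_mono[OF runs_Seq[OF 1 runs_Seq[OF 2 3]]]) (simp add: bounded_time_def x)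
  moreover have "(x, \<sigma> 2) \<in> bounded_geodesic_length_problem G S"
    using word_problem_memI(3)[OF w, where k = k] by (simp add: x \<sigma> encode_bool_eq)
  ultimately show "\<exists>\<sigma>. (x, \<sigma> 2) \<in> bounded_geodesic_length_problem G S \<and>
      runs (bounded_program Q) ((\<lambda>_. [])(3 := x)) \<sigma> (bounded_time (length x))"
    by blast
qed

end

section \<open>Greedy construction of a geodesic\<close>

context geodesic_calls
begin

text \<open>The second alternative also records that every letter failed. The search needs this to
  know that it stops before the counter reaches the geodesic length of \<open>v\<close>.\<close>

lemma runs_attempt:
  assumes Q: "decides Q" and v: "v \<in> group_words S" and n: "length v + 1 + length (digits k :: 'a symbol list) \<le> n"
    and "set xs \<subseteq> letters S"
  shows "(\<exists>x\<in>set xs. glen (inv_letter x # v) \<le> k \<and>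
      runs (attempt Q xs) (search_state [] v k u) (search_state [One] (inv_letter x # v) k (x # u))
        (attempt_time (length xs) n)) \<or>
    (\<forall>x\<in>set xs. k < glen (inv_letter x # v)) \<and>
      runs (attempt Q xs) (search_state [] v k u) (search_state [Zero] v k u) (attempt_time (length xs) n)"
  using assms(4)
proof (induction xs)
  case Nil
  have "runs (push 2 Zero) (search_state [] v k u) (search_state [Zero] v k u) 2"
    by (rule runs_eq[OF runs_push]) (auto simp: search_state_def fun_eq_iff)
  then show ?case by (simp add: attempt_time_def numeral_2_eq_2)
next
  case (Cons x xs)
  let ?v = "inv_letter x # v"
  have x: "x \<in> letters S" "inv_letter x \<in> letters S" using Cons.prems inv_letter_in by auto
  have v': "?v \<in> group_words S" using v x by (auto simp: group_words_iff)
  have 1: "runs (push 3 (Letter (inv_letter x))) (search_state [] v k u) (search_state [] ?v k u) 2"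
    by (rule runs_eq[OF runs_push]) (auto simp: search_state_def fun_eq_iff encode_word_def x Letter_in)
  have 2: "runs Q (search_state [] ?v k u) (search_state [bool_symbol (glen ?v \<le> k)] ?v k u) (query_time n)"
    using n by (intro runs_query Q v') simp
  let ?if = "if_top 2 One (push 5 (Letter x)) (pop 2 ;; pop 3 ;; attempt Q xs)"
  show ?case
  proof (cases "glen ?v \<le> k")
    case True
    have 3: "runs (push 5 (Letter x)) (search_state [bool_symbol (glen ?v \<le> k)] ?v k u) (search_state [One] ?v k (x # u)) 2"
      by (rule runs_eq[OF runs_push]) (auto simp: True search_state_def fun_eq_iff encode_word_def x Letter_in)
    have 4: "runs ?if (search_state [bool_symbol (glen ?v \<le> k)] ?v k u) (search_state [One] ?v k (x # u)) (2 + 2)"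
      by (rule runs_if_topT[OF _ _ 3]) (auto simp: True search_state_def)
    have "runs (attempt Q (x # xs)) (search_state [] v k u) (search_state [One] ?v k (x # u))
        (attempt_time (length (x # xs)) n)"
      unfolding attempt.simps
      by (rule runs_mono[OF runs_Seq[OF 1 runs_Seq[OF 2 4]]]) (simp add: attempt_time_def)
    then show ?thesis using True by auto
  next
    case False
    have 3: "runs (pop 2 ;; pop 3) (search_state [bool_symbol (glen ?v \<le> k)] ?v k u) (search_state [] v k u) 2"
      by (rule runs_eq[OF runs_Seq[OF runs_pop runs_pop]])
        (auto simp: search_state_def fun_eq_iff encode_word_def)
    have *: "runs (attempt Q (x # xs)) (search_state [] v k u) \<sigma> (attempt_time (length (x # xs)) n)"
      if "runs (attempt Q xs) (search_state [] v k u) \<sigma> (attempt_time (length xs) n)" for \<sigma>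
    proof -
      have 4: "runs ?if (search_state [bool_symbol (glen ?v \<le> k)] ?v k u) \<sigma> (2 + attempt_time (length xs) n + 2)"
        by (rule runs_if_topF[OF _ _ runs_Seq_assoc[OF runs_Seq[OF 3 that]]])
          (use False in \<open>auto simp: search_state_def\<close>)
      show ?thesis unfolding attempt.simps
        by (rule runs_mono[OF runs_Seq[OF 1 runs_Seq[OF 2 4]]]) (simp add: attempt_time_def)
    qed
    show ?thesis using Cons.IH Cons.prems False * by auto
  qed
qed

text \<open>Invariant: no letter succeeds at the current \<open>k\<close>. Some letter does lower
  the geodesic length, so success comes at some \<open>k' < glen v\<close>, and whichever letter
  succeeds there leads to a length at most \<open>k'\<close>, hence below \<open>glen v\<close>. The
  base case contradicts \<open>k < glen v\<close>.\<close>

lemma runs_search_loop: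
  assumes Q: "decides Q" and v: "v \<in> group_words S" and n: "length v + glen v + 1 \<le> n"
    and xs: "set xs = letters S" and k: "k < glen v" and none: "\<forall>x\<in>letters S. k < glen (inv_letter x # v)"
  shows "\<exists>x\<in>letters S. \<exists>k'. glen (inv_letter x # v) < glen v \<and> k' < glen v \<and>
    runs (while_top 2 Zero (pop 2 ;; incr 4 6 ;; attempt Q xs)) (search_state [Zero] v k u)
      (search_state [One] (inv_letter x # v) k' (x # u))
      ((glen v - k) * (attempt_time (length xs) n + 9 * n + 10) + 1)"
  using k none
proof (induction "glen v - k" arbitrary: k)
  case (Suc d)
  let ?a = "attempt_time (length xs) n"
  let ?loop = "while_top 2 Zero (pop 2 ;; incr 4 6 ;; attempt Q xs)"
  obtain x0 where "x0 \<in> letters S" "glen (inv_letter x0 # v) < glen v"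
    using ex_geodesic_length_less[OF gens v] Suc.prems(1) by auto
  \<comment> \<open>The length reached by \<open>x0\<close> lies strictly between \<open>k\<close>,
    where all letters failed, and \<open>glen v\<close>. So even the next value of the counter is
    below \<open>glen v\<close>.\<close>
  then have k: "Suc k < glen v" using Suc.prems(2) by fastforce
  have len: "length (digits k :: 'a symbol list) \<le> n"
    "length v + 1 + length (digits (Suc k) :: 'a symbol list) \<le> n"
    using digits_length_bound[of k "glen v"] digits_length_bound[of "Suc k" "glen v"] k n by auto
  have 1: "runs (pop 2 ;; incr 4 6) (search_state [Zero] v k u) (search_state [] v (Suc k) u) (9 * n + 6)"
    by (rule runs_eq[OF runs_Seq[OF runs_pop runs_incr]])
      (use len in \<open>auto simp: search_state_def fun_eq_iff inc_digits_digits\<close>)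
  have loop: "runs ?loop (search_state [Zero] v k u) \<sigma>' ((glen v - k) * (?a + 9 * n + 10) + 1)"
    if "runs (attempt Q xs) (search_state [] v (Suc k) u) \<sigma> ?a"
      and "runs ?loop \<sigma> \<sigma>' ((glen v - Suc k) * (?a + 9 * n + 10) + 1)" for \<sigma> \<sigma>'
  proof -
    have "runs ?loop (search_state [Zero] v k u) \<sigma>'
        ((9 * n + 6 + ?a) + ((glen v - Suc k) * (?a + 9 * n + 10) + 1) + 2)"
      by (rule runs_while_topT[OF _ _ runs_Seq_assoc[OF runs_Seq[OF 1 that(1)]] that(2)])
        (auto simp: search_state_def)
    moreover have "glen v - k = Suc (glen v - Suc k)" using k by simp
    ultimately show ?thesis by (simp add: runs_mono)
  qed
  consider x where "x \<in> letters S" "glen (inv_letter x # v) \<le> Suc k"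
      "runs (attempt Q xs) (search_state [] v (Suc k) u) (search_state [One] (inv_letter x # v) (Suc k) (x # u)) ?a"
    | "\<forall>x\<in>letters S. Suc k < glen (inv_letter x # v)"
      "runs (attempt Q xs) (search_state [] v (Suc k) u) (search_state [Zero] v (Suc k) u) ?a"
    using runs_attempt[OF Q v len(2), of xs u] xs by auto
  then show ?case
  proof cases
    case (1 x)
    have "runs ?loop (search_state [One] (inv_letter x # v) (Suc k) (x # u))
        (search_state [One] (inv_letter x # v) (Suc k) (x # u)) 1"
      by (rule runs_while_topF) (auto simp: search_state_def)
    then have "runs ?loop (search_state [One] (inv_letter x # v) (Suc k) (x # u))
        (search_state [One] (inv_letter x # v) (Suc k) (x # u)) ((glen v - Suc k) * (?a + 9 * n + 10) + 1)"
      by (rule runs_mono) simp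
    from loop[OF 1(3) this] show ?thesis using 1 k by (meson le_less_trans)
  next
    case 2
    have "d = glen v - Suc k" using Suc.hyps(2) by simp
    from Suc.hyps(1)[OF this k 2(1)] loop[OF 2(2)] show ?thesis by blast
  qed
qed simp

lemma runs_search:
  assumes Q: "decides Q" and v: "v \<in> group_words S" and n: "length v + glen v + 1 \<le> n"
    and xs: "set xs = letters S" and pos: "0 < glen v"
  shows "\<exists>x\<in>letters S. \<exists>k. glen (inv_letter x # v) < glen v \<and> k < glen v \<and>
    runs (search Q xs) (search_state [] v 0 u) (search_state [One] (inv_letter x # v) k (x # u))
      (search_time (length xs) n)"
proof -
  let ?a = "attempt_time (length xs) n"
  let ?loop = "while_top 2 Zero (pop 2 ;; incr 4 6 ;; attempt Q xs)"
  have len: "length v + 1 + length (digits 0 :: 'a symbol list) \<le> n" using n pos by simp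
  have le: "glen v * (?a + 9 * n + 10) \<le> n * (?a + 9 * n + 10)"
    using n by (intro mult_right_mono) auto
  consider x where "x \<in> letters S" "glen (inv_letter x # v) \<le> 0"
      "runs (attempt Q xs) (search_state [] v 0 u) (search_state [One] (inv_letter x # v) 0 (x # u)) ?a"
    | "\<forall>x\<in>letters S. 0 < glen (inv_letter x # v)"
      "runs (attempt Q xs) (search_state [] v 0 u) (search_state [Zero] v 0 u) ?a"
    using runs_attempt[OF Q v len, of xs u] xs by auto
  then show ?thesis
  proof cases
    case (1 x)
    have "runs ?loop (search_state [One] (inv_letter x # v) 0 (x # u))
        (search_state [One] (inv_letter x # v) 0 (x # u)) 1"
      by (rule runs_while_topF) (auto simp: search_state_def)
    then have "runs (search Q xs) (search_state [] v 0 u) (search_state [One] (inv_letter x # v) 0 (x # u))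
        (search_time (length xs) n)"
      unfolding search_def by (rule runs_mono[OF runs_Seq[OF 1(3)]]) (simp add: search_time_def)
    then show ?thesis using 1 pos by (meson le_less_trans)
  next
    case 2
    obtain x k where x: "x \<in> letters S" "glen (inv_letter x # v) < glen v" "k < glen v"
      and loop: "runs ?loop (search_state [Zero] v 0 u) (search_state [One] (inv_letter x # v) k (x # u))
        ((glen v - 0) * (?a + 9 * n + 10) + 1)"
      using runs_search_loop[OF Q v n xs pos 2(1)] by blast
    have "runs (search Q xs) (search_state [] v 0 u) (search_state [One] (inv_letter x # v) k (x # u))
        (search_time (length xs) n)"
      unfolding search_def
      by (rule runs_mono[OF runs_Seq[OF 2(2) loop]]) (use le in \<open>simp add: search_time_def\<close>)
    then show ?thesis using x by blast
  qed
qed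

text \<open>Three quantities are invariant: the product of the values of \<open>rev u\<close> and
  \<open>v\<close>, the sum of \<open>length u\<close> and \<open>glen v\<close>, and the sum of
  \<open>length v\<close> and \<open>glen v\<close>. They give the value of the result, its minimal
  length, and a question size valid in all rounds.\<close>

lemma runs_geodesic_loop:
  assumes Q: "decides Q" and xs: "set xs = letters S"
    and "v \<in> group_words S" and "u \<in> group_words S" and "length v + glen v + 1 \<le> n"
  shows "\<exists>v' u'. v' \<in> group_words S \<and> glen v' = 0 \<and> u' \<in> group_words S \<and> length u' = length u + glen v \<and>
    word_value G (rev u') \<otimes> word_value G v' = word_value G (rev u) \<otimes> word_value G v \<and>
    runs (while_top 2 Zero (pop 2 ;; search Q xs ;; (pop 2 ;; clear 4 ;; push 4 Zero) ;; Q))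
      (search_state [bool_symbol (glen v \<le> 0)] v 0 u) (search_state [One] v' 0 u')
      (glen v * round_time (length xs) n + 1)"
  using assms(3-)
proof (induction "glen v" arbitrary: v u)
  case 0
  have "runs (while_top 2 Zero (pop 2 ;; search Q xs ;; (pop 2 ;; clear 4 ;; push 4 Zero) ;; Q))
      (search_state [One] v 0 u) (search_state [One] v 0 u) 1"
    by (rule runs_while_topF) (auto simp: search_state_def)
  then show ?case using 0 by (intro exI[of _ v] exI[of _ u]) simp
next
  case (Suc d)
  let ?loop = "while_top 2 Zero (pop 2 ;; search Q xs ;; (pop 2 ;; clear 4 ;; push 4 Zero) ;; Q)"
  note v = Suc.prems(1) and u = Suc.prems(2) and n = Suc.prems(3)
  have pos: "0 < glen v" using Suc.hyps(2) by simp
  obtain x k where x: "x \<in> letters S" and less: "glen (inv_letter x # v) < glen v" and k: "k < glen v"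
    and search: "runs (search Q xs) (search_state [] v 0 u) (search_state [One] (inv_letter x # v) k (x # u))
      (search_time (length xs) n)"
    using runs_search[OF Q v n xs pos] by blast
  let ?v = "inv_letter x # v" and ?u = "x # u"
  have v': "?v \<in> group_words S" and u': "?u \<in> group_words S"
    using v u x inv_letter_in by (auto simp: group_words_iff)
  \<comment> \<open>The search guarantees a decrease, and a single letter cannot lower the length by
    more than one. This exactness makes the collected word geodesic.\<close>
  have glen: "glen v = Suc (glen ?v)"
    using geodesic_length_le_Suc[OF gens x v] less by simp
  have n': "length ?v + glen ?v + 1 \<le> n" using n glen by simp
  have len: "length (digits k :: 'a symbol list) \<le> n"
    using digits_length_bound[OF k] n by simp
  have 1: "runs (pop 2) (search_state [bool_symbol (glen v \<le> 0)] v 0 u) (search_state [] v 0 u) 1"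
    by (rule runs_eq[OF runs_pop]) (auto simp: search_state_def fun_eq_iff)
  have 2: "runs (pop 2 ;; clear 4 ;; push 4 Zero) (search_state [One] ?v k ?u) (search_state [] ?v 0 ?u) (3 * n + 4)"
    by (rule runs_eq[OF runs_Seq[OF runs_pop runs_Seq[OF runs_clear runs_push]]])
      (use len in \<open>auto simp: search_state_def fun_eq_iff\<close>)
  have 3: "runs Q (search_state [] ?v 0 ?u) (search_state [bool_symbol (glen ?v \<le> 0)] ?v 0 ?u) (query_time n)"
    by (rule runs_query[OF Q v']) (use n glen in simp)
  have body: "runs (pop 2 ;; search Q xs ;; (pop 2 ;; clear 4 ;; push 4 Zero) ;; Q)
      (search_state [bool_symbol (glen v \<le> 0)] v 0 u) (search_state [bool_symbol (glen ?v \<le> 0)] ?v 0 ?u)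
      (1 + (search_time (length xs) n + (3 * n + 4 + query_time n)))"
    by (rule runs_Seq[OF 1 runs_Seq[OF search runs_Seq[OF 2 3]]])
  have "d = glen ?v" using glen Suc.hyps(2) by simp
  from Suc.hyps(1)[OF this v' u' n'] obtain v1 u1 where
    r: "v1 \<in> group_words S" "glen v1 = 0" "u1 \<in> group_words S" "length u1 = length ?u + glen ?v"
    "word_value G (rev u1) \<otimes> word_value G v1 = word_value G (rev ?u) \<otimes> word_value G ?v"
    and rest: "runs ?loop (search_state [bool_symbol (glen ?v \<le> 0)] ?v 0 ?u) (search_state [One] v1 0 u1)
      (glen ?v * round_time (length xs) n + 1)"
    by blast
  have "runs ?loop (search_state [bool_symbol (glen v \<le> 0)] v 0 u) (search_state [One] v1 0 u1)
      (1 + (search_time (length xs) n + (3 * n + 4 + query_time n)) + (glen ?v * round_time (length xs) n + 1) + 2)"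
    by (rule runs_while_topT[OF _ _ body rest]) (use pos in \<open>auto simp: search_state_def\<close>)
  then have "runs ?loop (search_state [bool_symbol (glen v \<le> 0)] v 0 u) (search_state [One] v1 0 u1)
      (glen v * round_time (length xs) n + 1)"
    by (rule runs_mono) (simp add: glen round_time_def)
  moreover have "word_value G (rev ?u) \<otimes> word_value G ?v = word_value G (rev u) \<otimes> word_value G v"
  proof -
    have ru: "rev u \<in> group_words S" and sx: "[x] \<in> group_words S"
      using u x by (auto simp: group_words_iff)
    \<comment> \<open>The stack \<open>u\<close> lists the letters latest first, so after reversal
      the new \<open>x\<close> stands directly before the inverse letter in front of
      \<open>v\<close>, and the two cancel.\<close>
    have "word_value G (rev ?u) \<otimes> word_value G ?v = word_value G (rev u @ x # inv_letter x # v)"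
      using word_value_append[OF gens, of "rev ?u" ?v] u' v' by (simp add: group_words_iff)
    also have "\<dots> = word_value G (rev u) \<otimes> word_value G (x # inv_letter x # v)"
      using ru v' x by (intro word_value_append[OF gens]) (auto simp: group_words_iff)
    finally show ?thesis using word_value_cancel(2)[OF gens x v] by simp
  qed
  ultimately show ?case using r glen by (intro exI[of _ v1] exI[of _ u1]) simp
qed

lemma solved_by_geodesic_program:
  assumes Q: "decides Q" and xs: "set xs = letters S"
  shows "solved_by (geodesic_problem G S) (geodesic_program Q xs) (geodesic_time (length xs))"
  unfolding solved_by_def
proof
  fix x assume "x \<in> Domain (geodesic_problem G S)"
  then obtain w where w: "w \<in> group_words S" and x: "x = encode_word w"
    by (auto elim: geodesic_problem_cases)
  let ?n = "2 * length w + 1"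
  have glen: "glen w \<le> length w" using w by (rule geodesic_length_word_le)
  have 1: "runs (push 4 Zero) ((\<lambda>_. [])(3 := x)) (search_state [] w 0 []) 2"
    by (rule runs_eq[OF runs_push]) (auto simp: x search_state_def fun_eq_iff encode_word_def)
  have 2: "runs Q (search_state [] w 0 []) (search_state [bool_symbol (glen w \<le> 0)] w 0 []) (query_time ?n)"
    by (rule runs_query[OF Q w]) simp
  obtain v u where r: "v \<in> group_words S" "glen v = 0" "u \<in> group_words S" "length u = glen w"
      "word_value G (rev u) \<otimes> word_value G v = word_value G w"
    and 3: "runs (while_top 2 Zero (pop 2 ;; search Q xs ;; (pop 2 ;; clear 4 ;; push 4 Zero) ;; Q))
      (search_state [bool_symbol (glen w \<le> 0)] w 0 []) (search_state [One] v 0 u)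
      (glen w * round_time (length xs) ?n + 1)"
    using runs_geodesic_loop[OF Q xs w, of "[]" ?n] glen word_value_closed[OF gens w]
    by (auto simp: group_words_iff)
  let ?\<sigma> = "(search_state [One] v 0 u)(2 := encode_word (rev u), 5 := [])"
  have 4: "runs (pop 2 ;; move_all 5 2 2) (search_state [One] v 0 u) ?\<sigma> (4 * length w + 6)"
    by (rule runs_eq[OF runs_Seq[OF runs_pop runs_move_all]])
      (use r glen in \<open>auto simp: search_state_def fun_eq_iff encode_word_def rev_map\<close>)
  have 3: "runs (while_top 2 Zero (pop 2 ;; search Q xs ;; (pop 2 ;; clear 4 ;; push 4 Zero) ;; Q))
      (search_state [bool_symbol (glen w \<le> 0)] w 0 []) (search_state [One] v 0 u)
      (length w * round_time (length xs) ?n + 1)"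
    by (rule runs_mono[OF 3]) (use glen in \<open>intro add_mono mult_right_mono, auto\<close>)
  have "runs (geodesic_program Q xs) ((\<lambda>_. [])(3 := x)) ?\<sigma> (geodesic_time (length xs) (length x))"
    unfolding geodesic_program_def
    by (rule runs_mono[OF runs_Seq[OF 1 runs_Seq[OF 2 runs_Seq[OF 3 4]]]]) (simp add: geodesic_time_def x)
  \<comment> \<open>The leftover \<open>v\<close> has geodesic length 0, hence trivial value, so the
    product invariant reduces to \<open>rev u\<close>.\<close>
  moreover have "word_value G (rev u) = word_value G w"
    using r geodesic_length_0[OF gens r(1,2)] word_value_closed[OF gens, of "rev u"]
    by (simp add: group_words_iff)
  then have "(x, ?\<sigma> 2) \<in> geodesic_problem G S"
    using word_problem_memI(1)[OF w, of "rev u" G] r by (simp add: x group_words_iff)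
  ultimately show "\<exists>\<sigma>. (x, \<sigma> 2) \<in> geodesic_problem G S \<and>
      runs (geodesic_program Q xs) ((\<lambda>_. [])(3 := x)) \<sigma> (geodesic_time (length xs) (length x))"
    by blast
qed

end

section \<open>The reductions\<close>

definition is_poly :: "(nat \<Rightarrow> nat) \<Rightarrow> bool" where
  "is_poly t \<longleftrightarrow> (\<exists>p. \<forall>n. t n = poly p n)"

lemma is_poly_const: "is_poly (\<lambda>_. c)"
  unfolding is_poly_def by (intro exI[of _ "[:c:]"]) simp

lemma is_poly_id: "is_poly (\<lambda>n. n)"
  unfolding is_poly_def by (intro exI[of _ "[:0, 1:]"]) simp

lemma is_poly_add:
  assumes "is_poly s" and "is_poly t"
  shows "is_poly (\<lambda>n. s n + t n)"
proof -
  obtain p q where "\<forall>n. s n = poly p n" "\<forall>n. t n = poly q n"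
    using assms by (auto simp: is_poly_def)
  then show ?thesis unfolding is_poly_def by (intro exI[of _ "p + q"]) simp
qed

lemma is_poly_mult:
  assumes "is_poly s" and "is_poly t"
  shows "is_poly (\<lambda>n. s n * t n)"
proof -
  obtain p q where "\<forall>n. s n = poly p n" "\<forall>n. t n = poly q n"
    using assms by (auto simp: is_poly_def)
  then show ?thesis unfolding is_poly_def by (intro exI[of _ "p * q"]) simp
qed

lemmas is_poly_intros = is_poly_const is_poly_id is_poly_add is_poly_mult

lemma is_poly_length_time: "is_poly length_time"
  unfolding length_time_def[abs_def] power2_eq_square by (intro is_poly_intros)

lemma is_poly_bounded_time: "is_poly bounded_time"
  unfolding bounded_time_def[abs_def] power2_eq_square by (intro is_poly_intros)

lemma is_poly_geodesic_time: "is_poly (geodesic_time l)"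
  unfolding geodesic_time_def[abs_def] round_time_def search_time_def attempt_time_def power2_eq_square
  by (intro is_poly_intros)

lemma length_answer_geodesic: "(y, z) \<in> geodesic_problem G S \<Longrightarrow> length z \<le> Suc (length y)"
  by (erule geodesic_problem_cases) (simp add: geodesic_length_word_le le_SucI)

text \<open>The additional symbol is used by the empty word: its answer is the single digit
  \<open>Zero\<close>.\<close>

lemma length_answer_length: "(y, z) \<in> geodesic_length_problem G S \<Longrightarrow> length z \<le> Suc (length y)"
  by (erule geodesic_length_problem_cases)
    (simp add: le_trans[OF length_encode_nat_le] geodesic_length_word_le)

lemma length_answer_bounded: "(y, z) \<in> bounded_geodesic_length_problem G S \<Longrightarrow> length z \<le> Suc (length y)"
  by (erule bounded_geodesic_length_problem_cases) (simp add: encode_bool_def)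

context geodesic_setting
begin

lemma finite_symbols: "finite (symbols S)"
  using finite_gens by (simp add: symbols_def letters_def)

lemma poly_reducible_solved_by:
  assumes lenA: "\<And>y z. (y, z) \<in> A \<Longrightarrow> length z \<le> Suc (length y)"
    and lenB: "\<And>y z. (y, z) \<in> B \<Longrightarrow> length z \<le> Suc (length y)"
    and inp: "\<And>x. x \<in> Domain A \<Longrightarrow> set x \<subseteq> symbols S"
    and calls: "\<And>f. solves f B \<Longrightarrow> geodesic_calls G S f (Domain B)"
    and solved: "\<And>f. solves f B \<Longrightarrow> geodesic_calls.solved_by S f (Domain B) A c t"
    and "is_poly t"
  shows "poly_reducible A B"
proof -
  obtain p where p: "\<And>n. t n = poly p n"
    using \<open>is_poly t\<close> by (auto simp: is_poly_def)
  \<comment> \<open>Reading the input and writing the output costs \<open>8 * n + 4\<close> plus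
    three steps per output symbol. The output has at most \<open>n + 1\<close> symbols, which gives
    \<open>11 * n + 7\<close>.\<close>
  define p0 where "p0 = p + [:7, 11:]"
  have p0: "poly p0 n = t n + 11 * n + 7" for n by (simp add: p0_def p)
  show ?thesis
  proof (rule poly_reducible_program[OF finite_symbols lenB inp])
    fix f x assume f: "solves f B" and x: "x \<in> Domain A"
    interpret geodesic_calls G S f "Domain B" using f by (rule calls)
    obtain \<sigma> where \<sigma>: "(x, \<sigma> 2) \<in> A" "runs c ((\<lambda>_. [])(3 := x)) \<sigma> (t (length x))"
      using solved[OF f] x unfolding solved_by_def by blast
    have "t (length x) + 8 * length x + 3 * length (\<sigma> 2) + 4 \<le> poly p0 (length x)"
      using lenA[OF \<sigma>(1)] by (simp add: p0)
    moreover obtain s m where "m \<le> t (length x) + 8 * length x + 3 * length (\<sigma> 2) + 4"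
      "tape_content (fst s 0) = \<sigma> 2"
      "exec (symbols S) f (Domain B) (read_from 0 2 3 ;; c ;; write_to 0 2) (cells (init x), head (init x)) s m"
      using exec_program[OF \<sigma>(2) inp[OF x]] by blast
    ultimately show "\<exists>s n. n \<le> poly p0 (length x) \<and> (x, tape_content (fst s 0)) \<in> A \<and>
        exec (symbols S) f (Domain B) (read_from 0 2 3 ;; c ;; write_to 0 2) (cells (init x), head (init x)) s n"
      using \<sigma>(1) by (intro exI[of _ s] exI[of _ m]) simp
  qed
qed

lemma geodesic_callsI:
  assumes "\<And>y z. (y, z) \<in> B \<Longrightarrow> set z \<subseteq> symbols S" and "solves f B"
  shows "geodesic_calls G S f (Domain B)"
proof unfold_locales
  show "set (f y) \<subseteq> symbols S" if "y \<in> Domain B" for y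
    using assms that by (auto simp: solves_def)
qed (auto simp: symbols_def)

text \<open>An element may have several geodesics and \<open>f\<close> may choose any of them; only
  the length of its answer is determined, and \<open>query_geodesic\<close> uses nothing
  else.\<close>

lemma geodesic_problem_calls:
  assumes f: "solves f (geodesic_problem G S)"
  shows "geodesic_calls G S f (Domain (geodesic_problem G S))"
    and "geodesic_calls.decides G S f (Domain (geodesic_problem G S)) query_geodesic"
proof -
  show calls: "geodesic_calls G S f (Domain (geodesic_problem G S))"
    by (rule geodesic_callsI[OF _ f]) (auto elim!: geodesic_problem_cases dest: set_encode_word)
  interpret geodesic_calls G S f "Domain (geodesic_problem G S)" by (rule calls)
  have dom: "encode_word v \<in> Domain (geodesic_problem G S)" if "v \<in> group_words S" for v
    using obtain_geodesic[OF that] word_problem_memI(1)[OF that] by (metis DomainI)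
  show "decides query_geodesic"
  proof (rule decides_query_geodesic[OF dom])
    fix v assume v: "v \<in> group_words S"
    have "(encode_word v, f (encode_word v)) \<in> geodesic_problem G S"
      using f dom[OF v] by (simp add: solves_def)
    then show "length (f (encode_word v)) = geodesic_length G S v"
      by (auto elim!: geodesic_problem_cases dest!: inj_encode_word)
  qed
qed

lemma geodesic_length_problem_calls:
  assumes f: "solves f (geodesic_length_problem G S)"
  shows "geodesic_calls G S f (Domain (geodesic_length_problem G S))"
    and "geodesic_calls.decides G S f (Domain (geodesic_length_problem G S)) query_length"
proof -
  show calls: "geodesic_calls G S f (Domain (geodesic_length_problem G S))"
    by (rule geodesic_callsI[OF _ f])
      (use set_encode_nat_symbols in \<open>auto elim!: geodesic_length_problem_cases\<close>)
  interpret geodesic_calls G S f "Domain (geodesic_length_problem G S)" by (rule calls)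
  have dom: "encode_word v \<in> Domain (geodesic_length_problem G S)" if "v \<in> group_words S" for v
    using word_problem_memI(2)[OF that] by (rule DomainI)
  show "decides query_length"
  proof (rule decides_query_length[OF dom])
    fix v assume v: "v \<in> group_words S"
    have "(encode_word v, f (encode_word v)) \<in> geodesic_length_problem G S"
      using f dom[OF v] by (simp add: solves_def)
    then show "f (encode_word v) = encode_nat (geodesic_length G S v)"
      by (auto elim!: geodesic_length_problem_cases dest!: inj_encode_word)
  qed
qed

lemma bounded_geodesic_length_problem_calls:
  assumes f: "solves f (bounded_geodesic_length_problem G S)"
  shows "geodesic_calls G S f (Domain (bounded_geodesic_length_problem G S))"
    and "geodesic_calls.decides G S f (Domain (bounded_geodesic_length_problem G S)) query_bounded"
proof -
  show calls: "geodesic_calls G S f (Domain (bounded_geodesic_length_problem G S))"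
    by (rule geodesic_callsI[OF _ f])
      (auto elim!: bounded_geodesic_length_problem_cases simp: encode_bool_def symbols_def split: if_splits)
  interpret geodesic_calls G S f "Domain (bounded_geodesic_length_problem G S)" by (rule calls)
  have int: "encode_nat k = encode_int (int k)" for k
    by (simp add: encode_int_def)
  have dom: "encode_word v @ Comma # encode_nat k \<in> Domain (bounded_geodesic_length_problem G S)"
    if "v \<in> group_words S" for v k
    using word_problem_memI(3)[OF that] unfolding int by (rule DomainI)
  show "decides query_bounded"
  proof (rule decides_query_bounded[OF dom])
    fix v k assume v: "v \<in> group_words S"
    have "(encode_word v @ Comma # encode_nat k, f (encode_word v @ Comma # encode_nat k))
        \<in> bounded_geodesic_length_problem G S"
      using f dom[OF v] by (simp add: solves_def)
    then show "f (encode_word v @ Comma # encode_nat k) = [bool_symbol (geodesic_length G S v \<le> k)]"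
      unfolding int
      by (auto elim!: bounded_geodesic_length_problem_cases
          dest!: encode_word_Comma_inject encode_int_inject simp: encode_bool_eq)
  qed
qed

lemma inputs_in:
  "x \<in> Domain (geodesic_problem G S) \<Longrightarrow> set x \<subseteq> symbols S"
  "x \<in> Domain (geodesic_length_problem G S) \<Longrightarrow> set x \<subseteq> symbols S"
  "x \<in> Domain (bounded_geodesic_length_problem G S) \<Longrightarrow> set x \<subseteq> symbols S"
proof -
  have "Comma \<in> symbols S" by (simp add: symbols_def)
  then show "x \<in> Domain (bounded_geodesic_length_problem G S) \<Longrightarrow> set x \<subseteq> symbols S"
    by (elim DomainE bounded_geodesic_length_problem_cases)
      (simp add: set_encode_word set_encode_int_symbols)
qed (elim DomainE geodesic_problem_cases geodesic_length_problem_cases, simp add: set_encode_word)+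

text \<open>A target problem enters only through its query program \<open>Q\<close>, which is the
  same for all its solutions \<open>f\<close>. Each choice of target yields reductions from all
  three problems.\<close>

lemma reductions:
  assumes lenB: "\<And>y z. (y, z) \<in> B \<Longrightarrow> length z \<le> Suc (length y)"
    and calls: "\<And>f. solves f B \<Longrightarrow> geodesic_calls G S f (Domain B)"
    and decides: "\<And>f. solves f B \<Longrightarrow> geodesic_calls.decides G S f (Domain B) Q"
  shows "poly_reducible (geodesic_problem G S) B"
    and "poly_reducible (geodesic_length_problem G S) B"
    and "poly_reducible (bounded_geodesic_length_problem G S) B"
proof -
  have "finite (letters S)" using finite_gens by (simp add: letters_def)
  \<comment> \<open>The letters to be tried are hard-wired into the program as a list, which is
    possible because there are finitely many generators.\<close>
  then obtain xs where xs: "set xs = letters S" using finite_list by blast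
  show "poly_reducible (geodesic_problem G S) B"
  proof (rule poly_reducible_solved_by)
    show "geodesic_calls.solved_by S f (Domain B) (geodesic_problem G S) (geodesic_program Q xs) (geodesic_time (length xs))"
      if "solves f B" for f
      by (rule geodesic_calls.solved_by_geodesic_program[OF calls[OF that] decides[OF that] xs])
  qed (fact length_answer_geodesic lenB inputs_in calls is_poly_geodesic_time)+
  show "poly_reducible (geodesic_length_problem G S) B"
  proof (rule poly_reducible_solved_by)
    show "geodesic_calls.solved_by S f (Domain B) (geodesic_length_problem G S) (length_program Q) length_time"
      if "solves f B" for f
      by (rule geodesic_calls.solved_by_length_program[OF calls[OF that] decides[OF that]])
  qed (fact length_answer_length lenB inputs_in calls is_poly_length_time)+
  show "poly_reducible (bounded_geodesic_length_problem G S) B"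
  proof (rule poly_reducible_solved_by)
    show "geodesic_calls.solved_by S f (Domain B) (bounded_geodesic_length_problem G S) (bounded_program Q) bounded_time"
      if "solves f B" for f
      by (rule geodesic_calls.solved_by_bounded_program[OF calls[OF that] decides[OF that]])
  qed (fact length_answer_bounded lenB inputs_in calls is_poly_bounded_time)+
qed

end

theorem proposition1:
  fixes G :: "('a, 'b) monoid_scheme" and S :: "'a set"
  assumes "group G" and "finite S" and "S \<subseteq> carrier G" and "generate G S = carrier G"
  shows "poly_reducible (geodesic_problem G S) (geodesic_length_problem G S) \<and>
         poly_reducible (geodesic_length_problem G S) (geodesic_problem G S) \<and>
         poly_reducible (geodesic_problem G S) (bounded_geodesic_length_problem G S) \<and>
         poly_reducible (bounded_geodesic_length_problem G S) (geodesic_problem G S) \<and>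
         poly_reducible (geodesic_length_problem G S) (bounded_geodesic_length_problem G S) \<and>
         poly_reducible (bounded_geodesic_length_problem G S) (geodesic_length_problem G S)"
proof -
  interpret geodesic_setting G S
    using assms by (intro geodesic_setting.intro geodesic_setting_axioms.intro)
  note to_geodesic = reductions[OF length_answer_geodesic geodesic_problem_calls]
  note to_length = reductions[OF length_answer_length geodesic_length_problem_calls]
  note to_bounded = reductions[OF length_answer_bounded bounded_geodesic_length_problem_calls]
  show ?thesis
    by (intro conjI to_length(1) to_geodesic(2) to_bounded(1) to_geodesic(3) to_bounded(2) to_length(3))
qed

end
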